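(* Let $d>2$, $\Omega\subseteq\mathbb{R}^d$ open, $2\le k\le d-1$ (no parity assumption on $k,d$), $p\ge1$. Let $f\in W^{1,p}(\Omega,\mathbb{R}^d)$ with either $\det df>0$ a.e. or $\det df<0$ a.e., suppose that $x\mapsto\bigwedge^kdf_x$ has a smooth representative taking values in $\operatorname{GL}(\bigwedge^k\mathbb{R}^d)$ everywhere, and suppose in addition that the weak derivatives of $f$ are continuous (have continuous representatives). Then $f$ is smooth.
   Context: $\bigwedge^kA$ is the endomorphism of $\bigwedge^k\mathbb{R}^d$ given by $v_1\wedge\dots\wedge v_k\mapsto Av_1\wedge\dots\wedge Av_k$. *)

theory Defs
  imports "HOL-Analysis.Analysis"
begin

definition partial :: "'n::finite \<Rightarrow> (real^'n \<Rightarrow> real) \<Rightarrow> real^'n \<Rightarrow> real" where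
  "partial j h x = deriv (\<lambda>t. h (x + t *\<^sub>R axis j 1)) 0"

fun iter_partial :: "'n::finite list \<Rightarrow> (real^'n \<Rightarrow> real) \<Rightarrow> real^'n \<Rightarrow> real" where
  "iter_partial [] h = h"
| "iter_partial (j # js) h = partial j (iter_partial js h)"

definition smooth_on :: "(real^'n::finite) set \<Rightarrow> (real^'n \<Rightarrow> real) \<Rightarrow> bool" where
  "smooth_on U h \<longleftrightarrow>
     (\<forall>js. continuous_on U (iter_partial js h) \<and>
           (\<forall>j. \<forall>x\<in>U. (\<lambda>t. iter_partial js h (x + t *\<^sub>R axis j 1)) differentiable (at 0)))"

definition smooth_vec_on :: "(real^'n::finite) set \<Rightarrow> (real^'n \<Rightarrow> real^'m::finite) \<Rightarrow> bool" where
  "smooth_vec_on U f \<longleftrightarrow> (\<forall>i. smooth_on U (\<lambda>x. f x $ i))"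

definition test_fun :: "(real^'n::finite) set \<Rightarrow> (real^'n \<Rightarrow> real) \<Rightarrow> bool" where
  "test_fun U \<phi> \<longleftrightarrow> smooth_on U \<phi> \<and> compact (closure {x. \<phi> x \<noteq> 0}) \<and> closure {x. \<phi> x \<noteq> 0} \<subseteq> U"

definition Lp_on :: "real \<Rightarrow> (real^'n::finite) set \<Rightarrow> (real^'n \<Rightarrow> 'b::euclidean_space) \<Rightarrow> bool" where
  "Lp_on p U f \<longleftrightarrow> f \<in> borel_measurable (lebesgue_on U) \<and>
     (\<integral>\<^sup>+ x. ennreal (norm (f x) powr p) \<partial>(lebesgue_on U)) < \<infinity>"

definition weak_jacobian_on :: "(real^'n::finite) set \<Rightarrow> (real^'n \<Rightarrow> real^'m::finite) \<Rightarrow> (real^'n \<Rightarrow> real^'n^'m) \<Rightarrow> bool" where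
  "weak_jacobian_on U f g \<longleftrightarrow>
     (\<forall>\<phi> i j. test_fun U \<phi> \<longrightarrow>
        integral\<^sup>L (lebesgue_on U) (\<lambda>x. f x $ i * partial j \<phi> x)
        = - integral\<^sup>L (lebesgue_on U) (\<lambda>x. g x $ i $ j * \<phi> x))"

definition sobolev_W1p :: "real \<Rightarrow> (real^'n::finite) set \<Rightarrow> (real^'n \<Rightarrow> real^'m::finite) \<Rightarrow> (real^'n \<Rightarrow> real^'n^'m) \<Rightarrow> bool" where
  "sobolev_W1p p U f g \<longleftrightarrow> Lp_on p U f \<and> (\<forall>i j. Lp_on p U (\<lambda>x. g x $ i $ j)) \<and> weak_jacobian_on U f g"

text \<open>Minor of A with rows I and columns J (both listed in increasing order), via the Leibniz formula.
  These are the matrix entries of the k-th exterior power of A w.r.t. the basis e_I = e_{i1} wedge ... wedge e_{ik}, i1 < ... < ik.\<close>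
definition minor :: "real^('n::{finite,linorder})^('n::{finite,linorder}) \<Rightarrow> 'n set \<Rightarrow> 'n set \<Rightarrow> real" where
  "minor A I J = (let r = sorted_list_of_set I; c = sorted_list_of_set J; k = card I in
     \<Sum>p | p permutes {..<k}. of_int (sign p) * (\<Prod>a<k. A $ (r ! a) $ (c ! (p a))))"

definition ksubsets :: "nat \<Rightarrow> 'n::finite set set" where
  "ksubsets k = {I. card I = k}"

text \<open>Matrix of bigwedge^k A: indexed by pairs of k-subsets.\<close>
definition ext_power :: "nat \<Rightarrow> real^('n::{finite,linorder})^('n::{finite,linorder}) \<Rightarrow> 'n set \<Rightarrow> 'n set \<Rightarrow> real" where
  "ext_power k A I J = minor A I J"

definition GL_ksub :: "nat \<Rightarrow> ('n::finite set \<Rightarrow> 'n set \<Rightarrow> real) \<Rightarrow> bool" where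
  "GL_ksub k M \<longleftrightarrow> (\<forall>v :: 'n set \<Rightarrow> real.
      (\<forall>I\<in>ksubsets k. (\<Sum>J\<in>ksubsets k. M I J * v J) = 0) \<longrightarrow> (\<forall>J\<in>ksubsets k. v J = 0))"

end

theory Submission
  imports Defs
begin

text \<open>
  The differential of \<open>A \<mapsto> \<Lambda>\<^sup>k A\<close> at the identity is injective for \<open>1 \<le> k < d\<close>, and by Cauchy-Binet so is its
  differential at every invertible matrix. Hence, if \<open>g\<close> is continuous and invertible and \<open>\<Lambda>\<^sup>k g\<close> is smooth, the
  increments of \<open>g\<close> are controlled by those of \<open>\<Lambda>\<^sup>k g\<close>, and \<open>\<partial>\<^sub>j g = V\<^sub>j g\<close>, where \<open>V\<^sub>j\<close> is a polynomial in \<open>g\<close>,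
  its inverse and the derivatives of \<open>\<Lambda>\<^sup>k g\<close>: bootstrapping makes \<open>g\<close> smooth. Invertibility of \<open>g\<close> follows from that of
  \<open>\<Lambda>\<^sup>k g\<close>. Finally, mollifications of \<open>f\<close> have gradients converging locally uniformly to the continuous weak gradient \<open>g\<close>,
  so they converge locally uniformly to a function with classical gradient \<open>g\<close>, which equals \<open>f\<close> almost everywhere since it has
  the same integrals over boxes.
\<close>

section \<open>Functions of class \<open>C\<^sup>m\<close>\<close>

text \<open>For even \<open>k\<close> the matrices \<open>A\<close> and \<open>-A\<close> have the
  same exterior power, so \<open>g\<close> cannot be recovered from its minors by a global inverse;
  only the differential is injective, and the continuity of \<open>g\<close> keeps increments on one
  branch. Linearising at the identity suffices: for fixed \<open>x\<close> the path
  \<open>g (x + t e_j) ** matrix_inv (g x)\<close> passes through it at \<open>t = 0\<close>, and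
  its minors are linear combinations of those of \<open>g\<close> along the line. For
  \<open>k = CARD('n)\<close> the differential at the identity would see the trace alone, so an
  index outside some \<open>k\<close>-subset has to exist. Smoothness is defined by iterated partial
  derivatives. Functions of \<open>x\<close> are therefore differentiated along coordinate axes
  only, and estimates live on boxes, where two points are joined by changing one coordinate at a
  time. The gradients of the mollified functions control their increments but not their values; box
  integrals supply the missing additive constant and identify the limit with
  \<open>f\<close>.\<close>

primrec ck :: "nat \<Rightarrow> (real^'n::finite) set \<Rightarrow> (real^'n \<Rightarrow> real) \<Rightarrow> bool" where
  "ck 0 U h \<longleftrightarrow> continuous_on U h"
| "ck (Suc m) U h \<longleftrightarrow> continuous_on U h
     \<and> (\<forall>j. \<forall>x\<in>U. (\<lambda>t. h (x + t *\<^sub>R axis j 1)) differentiable (at 0)) \<and> (\<forall>j. ck m U (partial j h))"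

lemma iter_partial_snoc: "iter_partial (js @ [j]) h = iter_partial js (partial j h)"
  by (induction js) auto

lemma smooth_on_partial: "smooth_on U h \<Longrightarrow> smooth_on U (partial j h)"
  unfolding smooth_on_def by (metis iter_partial_snoc)

text \<open>\<open>smooth_on\<close> treats all lists of directions at once and offers no order to
  induct on; the graded \<open>ck\<close> does. It strips the innermost derivative, the last entry
  of the list, whereas \<open>iter_partial\<close> adds the outermost one: hence the snoc rule in
  one direction and an induction on the list in the other.\<close>

lemma smooth_on_iff_ck: "smooth_on U h \<longleftrightarrow> (\<forall>m. ck m U h)"
proof
  have "smooth_on U h \<Longrightarrow> ck m U h" for m
  proof (induction m arbitrary: h)
    case 0
    then have "continuous_on U (iter_partial [] h)" unfolding smooth_on_def by blast
    then show ?case by simp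
  next
    case (Suc m)
    then have "ck m U (partial j h)" for j by (simp add: smooth_on_partial)
    moreover have "continuous_on U h" "\<forall>j. \<forall>x\<in>U. (\<lambda>t. h (x + t *\<^sub>R axis j 1)) differentiable (at 0)"
      using Suc.prems[unfolded smooth_on_def, rule_format, of "[]"] by auto
    ultimately show ?case by simp
  qed
  then show "smooth_on U h \<Longrightarrow> \<forall>m. ck m U h" by blast
next
  assume *: "\<forall>m. ck m U h"
  have "\<forall>m. ck m U (iter_partial js h)" for js
  proof (induction js)
    case Nil then show ?case using * by simp
  next
    case (Cons j js)
    then have "ck (Suc m) U (iter_partial js h)" for m by blast
    then show ?case by simp
  qed
  then have "ck (Suc 0) U (iter_partial js h)" for js by blast
  then show "smooth_on U h" unfolding smooth_on_def by simp
qed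

lemma ck_imp_continuous_on: "ck m U h \<Longrightarrow> continuous_on U h"
  by (cases m) auto

text \<open>This makes derivatives local: \<open>deriv\<close> at 0 depends only on the germ along
  the line, so \<open>partial\<close> and \<open>ck\<close> on an open set ignore the values
  elsewhere.\<close>

lemma eventually_line_in_open:
  fixes x v :: "'a::real_normed_vector"
  assumes "open U" "x \<in> U"
  shows "eventually (\<lambda>t. x + t *\<^sub>R v \<in> U) (nhds 0)"
proof -
  have "isCont (\<lambda>t. x + t *\<^sub>R v) 0" by (intro continuous_intros)
  then have "filterlim (\<lambda>t. x + t *\<^sub>R v) (nhds x) (nhds 0)"
    by (simp add: isCont_def tendsto_nhds_iff)
  then show ?thesis using topological_tendstoD assms by blast
qed

lemma partial_cong:
  assumes "open U" "x \<in> U" "\<And>y. y \<in> U \<Longrightarrow> f y = h y"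
  shows "partial j f x = partial j h x"
  unfolding partial_def
  by (intro deriv_cong_ev refl eventually_mono[OF eventually_line_in_open[OF assms(1,2)]] assms(3))

lemma line_differentiable_cong:
  fixes x :: "real^'n::finite" and f h :: "real^'n \<Rightarrow> real"
  assumes "open U" "x \<in> U" "\<And>y. y \<in> U \<Longrightarrow> f y = h y"
  shows "(\<lambda>t. f (x + t *\<^sub>R axis j 1)) differentiable (at (0::real)) \<longleftrightarrow>
    (\<lambda>t. h (x + t *\<^sub>R axis j 1)) differentiable (at 0)"
proof -
  have ev: "eventually (\<lambda>t. f (x + t *\<^sub>R axis j 1) = h (x + t *\<^sub>R axis j 1)) (nhds 0)"
    by (intro eventually_mono[OF eventually_line_in_open[OF assms(1,2)]] assms(3))
  have "((\<lambda>t. f (x + t *\<^sub>R axis j 1)) has_field_derivative D) (at 0) \<longleftrightarrow>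
        ((\<lambda>t. h (x + t *\<^sub>R axis j 1)) has_field_derivative D) (at (0::real))" for D
    using ev by (intro DERIV_cong_ev) auto
  then show ?thesis unfolding real_differentiable_def by blast
qed

lemma ck_cong:
  assumes "open U" "\<And>y. y \<in> U \<Longrightarrow> f y = h y"
  shows "ck m U f \<longleftrightarrow> ck m U h"
  using assms(2)
proof (induction m arbitrary: f h)
  case 0
  then show ?case by (simp cong: continuous_on_cong)
next
  case (Suc m)
  have "ck m U (partial j f) \<longleftrightarrow> ck m U (partial j h)" for j
    using partial_cong[OF assms(1)] Suc.prems by (intro Suc.IH) blast
  moreover have "continuous_on U f \<longleftrightarrow> continuous_on U h"
    using Suc.prems by (intro continuous_on_cong) auto
  moreover have "(\<forall>x\<in>U. (\<lambda>t. f (x + t *\<^sub>R axis j 1)) differentiable (at 0)) \<longleftrightarrow> (\<forall>x\<in>U. (\<lambda>t. h (x + t *\<^sub>R axis j 1)) differentiable (at 0))" for j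
    using line_differentiable_cong[OF assms(1)] Suc.prems by blast
  ultimately show ?case by simp
qed

lemma smooth_on_cong:
  assumes "open U" "\<And>y. y \<in> U \<Longrightarrow> f y = h y"
  shows "smooth_on U f \<longleftrightarrow> smooth_on U h"
  unfolding smooth_on_iff_ck using ck_cong[of U f h] assms by blast

lemma partial_eqI:
  "((\<lambda>t. f (x + t *\<^sub>R axis j 1)) has_real_derivative D) (at 0) \<Longrightarrow> partial j f x = D"
  unfolding partial_def by (rule DERIV_imp_deriv)

text \<open>A derivative formula valid only on \<open>U\<close> may stand in for
  \<open>partial j f\<close>, whose values off \<open>U\<close> are uncontrolled.\<close>

lemma ck_SucI:
  assumes "open U" "continuous_on U f"
    and "\<And>j x. x \<in> U \<Longrightarrow> ((\<lambda>t. f (x + t *\<^sub>R axis j 1)) has_real_derivative D j x) (at 0)"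
    and "\<And>j. ck m U (D j)"
  shows "ck (Suc m) U f"
proof -
  have "ck m U (partial j f)" for j
    using ck_cong[OF assms(1), of "partial j f" "D j"] partial_eqI[OF assms(3)] assms(4) by blast
  moreover have "(\<lambda>t. f (x + t *\<^sub>R axis j 1)) differentiable (at 0)" if "x \<in> U" for j x
    using assms(3)[OF that] real_differentiable_def by blast
  ultimately show ?thesis using assms(2) by simp
qed

lemma ck_SucD:
  assumes "ck (Suc m) U f" "x \<in> U"
  shows "((\<lambda>t. f (x + t *\<^sub>R axis j 1)) has_real_derivative partial j f x) (at 0)"
  using assms unfolding partial_def
  by (simp add: DERIV_deriv_iff_real_differentiable)

lemma ck_Suc_imp_ck: "ck (Suc m) U f \<Longrightarrow> ck m U f"
proof (induction m arbitrary: f)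
  case 0 then show ?case by simp
next
  case (Suc m)
  have "ck m U (partial j f)" for j using Suc.prems by (intro Suc.IH) simp
  then show ?case using Suc.prems by simp
qed

lemma ck_Suc_partial: "ck (Suc m) U f \<Longrightarrow> ck m U (partial j f)"
  by simp

lemma ck_const: "open U \<Longrightarrow> ck m U (\<lambda>x. c)"
proof (induction m arbitrary: c)
  case (Suc m)
  then show ?case by (intro ck_SucI[where D="\<lambda>j x. 0"]) auto
qed simp

lemma ck_add: "open U \<Longrightarrow> ck m U f \<Longrightarrow> ck m U h \<Longrightarrow> ck m U (\<lambda>x. f x + h x)"
proof (induction m arbitrary: f h)
  case (Suc m)
  show ?case
  proof (rule ck_SucI[where D="\<lambda>j x. partial j f x + partial j h x"])
    show "continuous_on U (\<lambda>x. f x + h x)"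
      by (intro continuous_on_add ck_imp_continuous_on[OF Suc.prems(2)] ck_imp_continuous_on[OF Suc.prems(3)])
    show "((\<lambda>t. f (x + t *\<^sub>R axis j 1) + h (x + t *\<^sub>R axis j 1)) has_real_derivative
      partial j f x + partial j h x) (at 0)" if "x \<in> U" for j x
      by (intro DERIV_add ck_SucD[OF Suc.prems(2) that] ck_SucD[OF Suc.prems(3) that])
    show "ck m U (\<lambda>x. partial j f x + partial j h x)" for j
      using Suc.prems by (intro Suc.IH) auto
  qed fact
qed (simp add: continuous_on_add)

lemma ck_mult: "open U \<Longrightarrow> ck m U f \<Longrightarrow> ck m U h \<Longrightarrow> ck m U (\<lambda>x. f x * h x)"
proof (induction m arbitrary: f h)
  case 0
  then show ?case by (simp add: continuous_on_mult)
next
  case (Suc m)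
  have f: "ck m U f" "ck m U (partial j f)" and h: "ck m U h" "ck m U (partial j h)" for j
    by (rule ck_Suc_imp_ck ck_Suc_partial, fact)+
  show ?case
  proof (rule ck_SucI[where D="\<lambda>j x. partial j f x * h x + f x * partial j h x"])
    show "continuous_on U (\<lambda>x. f x * h x)"
      by (intro continuous_on_mult ck_imp_continuous_on[OF f(1)] ck_imp_continuous_on[OF h(1)])
    show "((\<lambda>t. f (x + t *\<^sub>R axis j 1) * h (x + t *\<^sub>R axis j 1)) has_real_derivative
      partial j f x * h x + f x * partial j h x) (at 0)" if "x \<in> U" for j x
      using DERIV_mult[OF ck_SucD[OF Suc.prems(2) that] ck_SucD[OF Suc.prems(3) that]]
      by (simp add: algebra_simps)
    show "ck m U (\<lambda>x. partial j f x * h x + f x * partial j h x)" for j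
      by (rule ck_add[OF Suc.prems(1) Suc.IH[OF Suc.prems(1) f(2) h(1)] Suc.IH[OF Suc.prems(1) f(1) h(2)]])
  qed fact
qed

lemma ck_cmult: "open U \<Longrightarrow> ck m U f \<Longrightarrow> ck m U (\<lambda>x. c * f x)"
  by (intro ck_mult ck_const)

lemma ck_minus: "open U \<Longrightarrow> ck m U f \<Longrightarrow> ck m U (\<lambda>x. - f x)"
  using ck_cmult[of U m f "-1"] by simp

lemma ck_sum: "open U \<Longrightarrow> (\<And>i. i \<in> I \<Longrightarrow> ck m U (f i)) \<Longrightarrow> ck m U (\<lambda>x. \<Sum>i\<in>I. f i x)"
  by (induction I rule: infinite_finite_induct) (simp_all add: ck_add ck_const)

lemma ck_prod: "open U \<Longrightarrow> (\<And>i. i \<in> I \<Longrightarrow> ck m U (f i)) \<Longrightarrow> ck m U (\<lambda>x. \<Prod>i\<in>I. f i x)"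
  by (induction I rule: infinite_finite_induct) (simp_all add: ck_mult ck_const)

lemma ck_inverse:
  assumes "open U" "\<And>x. x \<in> U \<Longrightarrow> f x \<noteq> 0"
  shows "ck m U f \<Longrightarrow> ck m U (\<lambda>x. inverse (f x))"
proof (induction m)
  case 0
  then show ?case using assms by (simp add: continuous_on_inverse)
next
  case (Suc m)
  have f: "ck m U f" "ck m U (partial j f)" for j
    by (rule ck_Suc_imp_ck ck_Suc_partial, fact)+
  show ?case
  \<comment> \<open>The reciprocal of \<open>f\<close> enters its own derivative undifferentiated,
    so the induction hypothesis at order \<open>m\<close> covers it.\<close>
  proof (rule ck_SucI[where D="\<lambda>j x. - (partial j f x * (inverse (f x) * inverse (f x)))"])
    show "continuous_on U (\<lambda>x. inverse (f x))"
      using continuous_on_inverse[OF ck_imp_continuous_on[OF f(1)]] assms by blast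
    show "((\<lambda>t. inverse (f (x + t *\<^sub>R axis j 1))) has_real_derivative
      - (partial j f x * (inverse (f x) * inverse (f x)))) (at 0)" if "x \<in> U" for j x
      using DERIV_inverse_fun[OF ck_SucD[OF Suc.prems that, of j]] assms(2)[OF that]
      by (simp add: algebra_simps)
    show "ck m U (\<lambda>x. - (partial j f x * (inverse (f x) * inverse (f x))))" for j
      by (rule ck_minus[OF assms(1) ck_mult[OF assms(1) f(2) ck_mult[OF assms(1) Suc.IH[OF f(1)] Suc.IH[OF f(1)]]]])
  qed fact
qed

section \<open>Minors and the Cauchy-Binet formula\<close>

text \<open>Unlike in \<^const>\<open>minor\<close>, the selections of rows and columns may be unordered or have repetitions.\<close>
definition mn :: "nat \<Rightarrow> real^'n^'n \<Rightarrow> (nat \<Rightarrow> 'n::finite) \<Rightarrow> (nat \<Rightarrow> 'n) \<Rightarrow> real" where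
  "mn k A r c = (\<Sum>p | p permutes {..<k}. of_int (sign p) * (\<Prod>a<k. A $ r a $ c (p a)))"

abbreviation en :: "'n::{finite,linorder} set \<Rightarrow> nat \<Rightarrow> 'n" where
  "en J \<equiv> (!) (sorted_list_of_set J)"

lemma minor_ksubsets: "I \<in> ksubsets k \<Longrightarrow> minor A I J = mn k A (en I) (en J)"
  by (auto simp: ksubsets_def minor_def mn_def Let_def)

lemma mn_cong_cols: "(\<And>b. b < k \<Longrightarrow> c b = c' b) \<Longrightarrow> mn k A r c = mn k A r c'"
  unfolding mn_def
proof (intro sum.cong refl arg_cong2[where f="(*)"] prod.cong)
  fix p a assume c: "\<And>b. b < k \<Longrightarrow> c b = c' b" and "p \<in> {p. p permutes {..<k}}" "a \<in> {..<k}"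
  then have "p a < k" using permutes_in_image[of p "{..<k}" a] by simp
  then show "A $ r a $ c (p a) = A $ r a $ c' (p a)" by (simp add: c)
qed

text \<open>Reindexing by the inverse permutation, which has the same sign. The product then runs
  over columns, the form in which a matrix product in the first argument can be expanded.\<close>

lemma mn_by_rows: "mn k A r c = (\<Sum>p | p permutes {..<k}. of_int (sign p) * (\<Prod>b<k. A $ r (p b) $ c b))"
proof -
  have "mn k A r c = (\<Sum>p | p permutes {..<k}. of_int (sign (inv p)) * (\<Prod>a<k. A $ r a $ c (inv p a)))"
    unfolding mn_def by (rule sum_permutations_inverse)
  also have "\<dots> = (\<Sum>p | p permutes {..<k}. of_int (sign p) * (\<Prod>b<k. A $ r (p b) $ c b))"
  proof (intro sum.cong refl)
    fix p assume "p \<in> {p. p permutes {..<k}}"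
    then have p: "p permutes {..<k}" by simp
    have "(\<Prod>a<k. A $ r a $ c (inv p a)) = (\<Prod>b<k. A $ r (p b) $ c b)"
      using prod.permute[OF p, of "\<lambda>a. A $ r a $ c (inv p a)"] p
      by (simp add: o_def permutes_inverses)
    moreover have "sign (inv p) = sign p"
      using p by (simp add: sign_inverse permutes_imp_permutation[OF finite_lessThan])
    ultimately show "of_int (sign (inv p)) * (\<Prod>a<k. A $ r a $ c (inv p a)) = of_int (sign p) * (\<Prod>b<k. A $ r (p b) $ c b)"
      by simp
  qed
  finally show ?thesis .
qed

lemma mn_permute_cols:
  assumes q: "q permutes {..<k}"
  shows "mn k A r (c \<circ> q) = of_int (sign q) * mn k A r c"
proof -
  have qq: "of_int (sign q) * of_int (sign q) = (1::real)"
    by (simp add: sign_def)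
  have "of_int (sign q) * mn k A r c
    = of_int (sign q) * (\<Sum>p | p permutes {..<k}. of_int (sign (q \<circ> p)) * (\<Prod>a<k. A $ r a $ c ((q \<circ> p) a)))"
    unfolding mn_def using setum_permutations_compose_left[OF q, where f="\<lambda>p. of_int (sign p) * (\<Prod>a<k. A $ r a $ c (p a))"]
    by simp
  also have "\<dots> = mn k A r (c \<circ> q)"
    unfolding mn_def sum_distrib_left
  proof (intro sum.cong refl)
    fix p assume "p \<in> {p. p permutes {..<k}}"
    then have "sign (q \<circ> p) = sign q * sign p"
      using q by (simp add: sign_compose permutes_imp_permutation[OF finite_lessThan])
    then show "of_int (sign q) * (of_int (sign (q \<circ> p)) * (\<Prod>a<k. A $ r a $ c ((q \<circ> p) a))) =
        of_int (sign p) * (\<Prod>a<k. A $ r a $ (c \<circ> q) (p a))"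
      using qq by (simp add: mult.assoc[symmetric])
  qed
  finally show ?thesis by simp
qed

text \<open>Swapping two equal columns leaves the selection unchanged but flips the sign.\<close>

lemma mn_eq_0_if_not_inj:
  assumes "\<not> inj_on c {..<k}"
  shows "mn k A r c = 0"
proof -
  obtain a b where ab: "a < k" "b < k" "a \<noteq> b" "c a = c b"
    using assms by (auto simp: inj_on_def)
  let ?q = "Transposition.transpose a b"
  have "?q permutes {..<k}" using ab by (intro permutes_swap_id) auto
  moreover have "c \<circ> ?q = c" using ab by (auto simp: fun_eq_iff Transposition.transpose_def)
  moreover have "sign ?q = -1" using ab by (simp add: sign_swap_id)
  ultimately show ?thesis using mn_permute_cols[of ?q k A r c] by simp
qed

text \<open>The product of sums is distributed: \<open>\<phi> b\<close> is the inner summation index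
  chosen for column \<open>b\<close>. Using \<open>PiE\<close> keeps the set of choices
  finite.\<close>

lemma mn_mult_expand:
  "mn k (A ** U) r c = (\<Sum>\<phi>\<in>PiE {..<k} (\<lambda>_. UNIV). (\<Prod>b<k. U $ \<phi> b $ c b) * mn k A r \<phi>)"
proof -
  have "mn k (A ** U) r c = (\<Sum>p | p permutes {..<k}. of_int (sign p) *
     (\<Prod>b<k. \<Sum>l\<in>UNIV. A $ r (p b) $ l * U $ l $ c b))"
    unfolding mn_by_rows by (simp add: matrix_matrix_mult_def)
  also have "\<dots> = (\<Sum>p | p permutes {..<k}. \<Sum>\<phi>\<in>PiE {..<k} (\<lambda>_. UNIV). of_int (sign p) *
     (\<Prod>b<k. A $ r (p b) $ \<phi> b * U $ \<phi> b $ c b))"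
    by (subst prod_sum_PiE) (auto simp: sum_distrib_left)
  also have "\<dots> = (\<Sum>\<phi>\<in>PiE {..<k} (\<lambda>_. UNIV). \<Sum>p | p permutes {..<k}. of_int (sign p) *
     (\<Prod>b<k. A $ r (p b) $ \<phi> b * U $ \<phi> b $ c b))"
    by (rule sum.swap)
  also have "\<dots> = (\<Sum>\<phi>\<in>PiE {..<k} (\<lambda>_. UNIV). (\<Prod>b<k. U $ \<phi> b $ c b) * mn k A r \<phi>)"
    unfolding mn_by_rows sum_distrib_left by (intro sum.cong refl) (simp add: prod.distrib)
  finally show ?thesis .
qed

lemma bij_betw_en:
  "J \<in> ksubsets k \<Longrightarrow> bij_betw (en J) {..<k} J"
  using bij_betw_nth[of "sorted_list_of_set J" "{..<k}" J] by (simp add: ksubsets_def)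

text \<open>Two enumerations of \<open>J\<close> differ by a unique permutation. Members of
  \<open>PiE\<close> are \<open>undefined\<close> from \<open>k\<close> on, while permutations are
  the identity there: hence \<open>restrict\<close> in one direction and the conditional in the
  other.\<close>

lemma sum_over_enumerations:
  fixes e :: "nat \<Rightarrow> 'n"
  assumes "bij_betw e {..<k} J"
  shows "(\<Sum>\<phi> | \<phi> \<in> PiE {..<k} (\<lambda>_. UNIV) \<and> bij_betw \<phi> {..<k} J. F \<phi>)
    = (\<Sum>p | p permutes {..<k}. F (restrict (e \<circ> p) {..<k}))"
proof (rule sum.reindex_bij_witness[where j="\<lambda>\<phi> b. if b < k then inv_into {..<k} e (\<phi> b) else b"
      and i="\<lambda>p. restrict (e \<circ> p) {..<k}"], goal_cases)
  case (1 \<phi>)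
  then have "\<phi> b \<in> e ` {..<k}" if "b < k" for b
    using assms that by (auto simp: bij_betw_def)
  then have "e (inv_into {..<k} e (\<phi> b)) = \<phi> b" if "b < k" for b
    using that by (simp add: f_inv_into_f)
  then show ?case using 1 by (auto simp: fun_eq_iff PiE_def extensional_def)
next
  case (2 \<phi>)
  have "bij_betw (inv_into {..<k} e \<circ> \<phi>) {..<k} {..<k}"
    using 2 bij_betw_trans[OF _ bij_betw_inv_into[OF assms]] by blast
  then have "bij_betw (\<lambda>b. if b < k then inv_into {..<k} e (\<phi> b) else b) {..<k} {..<k}"
    by (rule bij_betw_cong[THEN iffD1, rotated]) auto
  then have "(\<lambda>b. if b < k then inv_into {..<k} e (\<phi> b) else b) permutes {..<k}"
    by (rule bij_imp_permutes) simp
  then show ?case by simp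
next
  case (3 p)
  then have p: "p permutes {..<k}" by simp
  have "inv_into {..<k} e (e (p b)) = p b" if "b < k" for b
    using that p assms permutes_in_image[OF p] by (auto simp: bij_betw_def)
  moreover have "p b = b" if "\<not> b < k" for b using p that by (simp add: permutes_def)
  ultimately show ?case by (auto simp: fun_eq_iff)
next
  case (4 p)
  then have p: "p permutes {..<k}" by simp
  have "bij_betw (e \<circ> p) {..<k} J"
    using permutes_imp_bij[OF p] assms by (rule bij_betw_trans)
  then have "bij_betw (restrict (e \<circ> p) {..<k}) {..<k} J"
    by (rule bij_betw_cong[THEN iffD1, rotated]) auto
  then show ?case by auto
next
  case (5 \<phi>)
  then have "\<phi> b \<in> e ` {..<k}" if "b < k" for b
    using assms that by (auto simp: bij_betw_def)
  then have "e (inv_into {..<k} e (\<phi> b)) = \<phi> b" if "b < k" for b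
    using that by (simp add: f_inv_into_f)
  then have "restrict (e \<circ> (\<lambda>b. if b < k then inv_into {..<k} e (\<phi> b) else b)) {..<k} = \<phi>"
    using 5 by (auto simp: fun_eq_iff PiE_def extensional_def)
  then show ?case by simp
qed

text \<open>In \<open>mn_mult_expand\<close> only injective \<open>\<phi>\<close> survive. Grouped
  by their image \<open>J\<close> they are the rearrangements of the increasing enumeration
  \<open>en J\<close>, and the sign from rearranging the columns of \<open>A\<close> completes the
  Leibniz sum of a minor of \<open>U\<close>.\<close>

theorem Cauchy_Binet:
  fixes A U :: "real^('n::{finite,linorder})^('n::{finite,linorder})"
  shows "mn k (A ** U) r c = (\<Sum>J\<in>ksubsets k. mn k A r (en J) * mn k U (en J) c)"
proof -
  let ?P = "PiE {..<k} (\<lambda>_. UNIV) :: (nat \<Rightarrow> 'n) set"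
  let ?F = "\<lambda>\<phi>. (\<Prod>b<k. U $ \<phi> b $ c b) * mn k A r \<phi>"
  have fin: "finite ?P" by (simp add: finite_PiE)
  have "mn k (A ** U) r c = (\<Sum>\<phi> | \<phi> \<in> ?P \<and> inj_on \<phi> {..<k}. ?F \<phi>)"
    unfolding mn_mult_expand
    by (rule sum.mono_neutral_right[OF fin]) (auto simp: mn_eq_0_if_not_inj)
  also have "\<dots> = (\<Sum>J\<in>ksubsets k. \<Sum>\<phi> | \<phi> \<in> {\<phi>. \<phi> \<in> ?P \<and> inj_on \<phi> {..<k}} \<and> \<phi> ` {..<k} = J. ?F \<phi>)"
    using fin sum.group[of "{\<phi>. \<phi> \<in> ?P \<and> inj_on \<phi> {..<k}}" "ksubsets k" "\<lambda>\<phi>. \<phi> ` {..<k}" ?F]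
    by (auto simp: ksubsets_def card_image image_subset_iff)
  also have "\<dots> = (\<Sum>J\<in>ksubsets k. \<Sum>\<phi> | \<phi> \<in> ?P \<and> bij_betw \<phi> {..<k} J. ?F \<phi>)"
    by (intro sum.cong refl) (auto simp: bij_betw_def)
  also have "\<dots> = (\<Sum>J\<in>ksubsets k. mn k A r (en J) * mn k U (en J) c)"
  proof (intro sum.cong refl)
    fix J :: "'n set" assume J: "J \<in> ksubsets k"
    have "(\<Sum>\<phi> | \<phi> \<in> ?P \<and> bij_betw \<phi> {..<k} J. ?F \<phi>)
      = (\<Sum>p | p permutes {..<k}. ?F (restrict (en J \<circ> p) {..<k}))"
      by (rule sum_over_enumerations[OF bij_betw_en[OF J]])
    also have "\<dots> = (\<Sum>p | p permutes {..<k}. mn k A r (en J) * (of_int (sign p) * (\<Prod>b<k. U $ en J (p b) $ c b)))"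
    proof (intro sum.cong refl)
      fix p assume "p \<in> {p. p permutes {..<k}}"
      then have p: "p permutes {..<k}" by simp
      have "mn k A r (restrict (en J \<circ> p) {..<k}) = mn k A r (en J \<circ> p)"
        by (rule mn_cong_cols) simp
      also have "\<dots> = of_int (sign p) * mn k A r (en J)"
        by (rule mn_permute_cols[OF p])
      finally have "mn k A r (restrict (en J \<circ> p) {..<k}) = of_int (sign p) * mn k A r (en J)" .
      then show "?F (restrict (en J \<circ> p) {..<k}) = mn k A r (en J) * (of_int (sign p) * (\<Prod>b<k. U $ en J (p b) $ c b))"
        by simp
    qed
    also have "\<dots> = mn k A r (en J) * mn k U (en J) c"
      unfolding mn_by_rows[of k U] sum_distrib_left ..
    finally show "(\<Sum>\<phi> | \<phi> \<in> ?P \<and> bij_betw \<phi> {..<k} J. ?F \<phi>) = mn k A r (en J) * mn k U (en J) c" .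
  qed
  finally show ?thesis .
qed

lemma minor_mult:
  "I \<in> ksubsets k \<Longrightarrow> minor (A ** U) I J = (\<Sum>L\<in>ksubsets k. minor A I L * minor U L J)"
  using Cauchy_Binet[of k A U "en I" "en J"] by (simp add: minor_ksubsets)

text \<open>Cauchy-Binet with an identity factor on either side. It allows unordered index sequences
  where only minors with increasing indices are given; the coefficients are 0 or signs.\<close>

lemma mn_eq_sum_minors:
  fixes A :: "real^('n::{finite,linorder})^('n::{finite,linorder})"
  shows "mn k A r c = (\<Sum>I\<in>ksubsets k. \<Sum>J\<in>ksubsets k. (mn k (mat 1) r (en I) * mn k (mat 1) (en J) c) * minor A I J)"
proof -
  have "mn k A r c = mn k (mat 1 ** (A ** mat 1)) r c" by simp
  also have "\<dots> = (\<Sum>I\<in>ksubsets k. mn k (mat 1) r (en I) * (\<Sum>J\<in>ksubsets k. mn k A (en I) (en J) * mn k (mat 1) (en J) c))"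
    unfolding Cauchy_Binet ..
  also have "\<dots> = (\<Sum>I\<in>ksubsets k. \<Sum>J\<in>ksubsets k. (mn k (mat 1) r (en I) * mn k (mat 1) (en J) c) * minor A I J)"
    unfolding sum_distrib_left
    by (intro sum.cong refl) (simp add: minor_ksubsets)
  finally show ?thesis .
qed

lemma mn_mat1_self:
  assumes "inj_on c {..<k}"
  shows "mn k (mat 1) c c = 1"
proof -
  have "(\<Prod>a<k. (mat 1 :: real^'a^'a) $ c a $ c (p a)) = (if p = id then 1 else 0)" if p: "p permutes {..<k}" for p
  proof (cases "p = id")
    case False
    then obtain a where "p a \<noteq> a" by (auto simp: fun_eq_iff)
    then have "a < k" using p by (auto simp: permutes_def)
    moreover from this have "c a \<noteq> c (p a)"
      using \<open>p a \<noteq> a\<close> assms permutes_in_image[OF p, of a] by (auto dest: inj_onD)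
    ultimately show ?thesis using False by (auto simp: mat_def intro!: prod_zero bexI[of _ a])
  qed (simp add: mat_def)
  then have "mn k (mat 1) c c = (\<Sum>p | p permutes {..<k}. of_int (sign p) * (if p = id then 1 else 0))"
    unfolding mn_def by (intro sum.cong refl) auto
  also have "\<dots> = (\<Sum>p | p permutes {..<k}. if p = id then 1 else 0)"
    by (intro sum.cong) (auto simp: sign_id)
  also have "\<dots> = 1"
    by (simp add: finite_permutations permutes_id)
  finally show ?thesis .
qed

section \<open>The differential of the exterior power\<close>

lemma ex_ksubset:
  assumes "finite B" "A \<subseteq> B" "card A \<le> k" "k \<le> card B"
  shows "\<exists>I. A \<subseteq> I \<and> I \<subseteq> B \<and> card I = k"
proof -
  have "finite A" using assms finite_subset by blast
  have "k - card A \<le> card (B - A)"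
    using assms \<open>finite A\<close> by (simp add: card_Diff_subset)
  then obtain C where C: "C \<subseteq> B - A" "card C = k - card A" "finite C"
    using obtain_subset_with_card_n by metis
  then have "card (A \<union> C) = k"
    using assms \<open>finite A\<close> by (subst card_Un_disjoint) auto
  then show ?thesis using C assms by blast
qed

text \<open>If \<open>A *v u = 0\<close> and \<open>u $ i0 \<noteq> 0\<close>, the wedge of
  \<open>u\<close> with the basis vectors of \<open>I - {i0}\<close> is a nonzero kernel vector of
  the exterior power. Its coordinates are the minors \<open>v J\<close> of \<open>U\<close>, the
  identity with column \<open>i0\<close> replaced by \<open>u\<close>.\<close>

lemma GL_ksub_imp_det_nz:
  fixes A :: "real^('n::{finite,linorder})^('n::{finite,linorder})"
  assumes k: "1 \<le> k" "k \<le> CARD('n)" and GL: "GL_ksub k (minor A)"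
  shows "det A \<noteq> 0"
proof
  assume "det A = 0"
  then have "\<not> (\<forall>x. A *v x = 0 \<longrightarrow> x = 0)"
    by (metis invertible_det_nz invertible_left_inverse matrix_left_invertible_ker)
  then obtain u where u: "A *v u = 0" "u \<noteq> 0" by blast
  then obtain i0 where i0: "u $ i0 \<noteq> 0" by (auto simp: vec_eq_iff)
  \<comment> \<open>\<open>mat 1 *v u\<close> is just \<open>u\<close>, spelled in the shape of
    Cramer's lemma, which yields \<open>det U = u $ i0\<close>.\<close>
  define U :: "((real, 'n) vec, 'n) vec" where "U = (\<chi> i j. if j = i0 then (mat 1 *v u) $ i else mat 1 $ i $ j)"
  have "det U = u $ i0" unfolding U_def cramer_lemma by simp
  then obtain W where W: "W ** U = mat 1"
    using i0 by (metis invertible_det_nz invertible_left_inverse)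
  obtain I where I: "i0 \<in> I" "card I = k"
    using ex_ksubset[of UNIV "{i0}" k] k by auto
  define c where "c = en I"
  have bij: "bij_betw c {..<k} I" unfolding c_def by (rule bij_betw_en) (simp add: ksubsets_def I)
  then obtain b0 where b0: "b0 < k" "c b0 = i0"
    using I(1) by (auto simp: bij_betw_def image_iff)
  have AU: "(A ** U) $ a $ i0 = 0" for a
    using u(1) by (simp add: matrix_matrix_mult_def U_def) (simp add: matrix_vector_mult_def vec_eq_iff)
  have prod0: "(\<Prod>b<k. (A ** U) $ r (p b) $ c b) = 0" for r p
    using b0 AU by (intro prod_zero) auto
  then have AU0: "mn k (A ** U) r c = 0" for r
    unfolding mn_by_rows by (simp only: prod0) simp
  define v where "v J = mn k U (en J) c" for J
  have "(\<Sum>J\<in>ksubsets k. minor A L J * v J) = 0" if "L \<in> ksubsets k" for L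
    using Cauchy_Binet[of k A U "en L" c] AU0[of "en L"] by (simp add: minor_ksubsets[OF that] v_def)
  then have v0: "\<forall>J\<in>ksubsets k. v J = 0"
    using GL unfolding GL_ksub_def by blast
  \<comment> \<open>If \<open>v\<close> were zero, a left inverse \<open>W\<close> of
    \<open>U\<close> would turn the minor \<open>mn k (mat 1) c c\<close>, which is 1, into
    0.\<close>
  have "mn k (W ** U) c c = (\<Sum>J\<in>ksubsets k. mn k W c (en J) * v J)"
    unfolding Cauchy_Binet v_def ..
  also have "\<dots> = 0" using v0 by simp
  finally show False using mn_mat1_self[of c k] bij W by (simp add: bij_betw_def)
qed

lemma mn_has_derivative:
  "((\<lambda>B. mn k B r c) has_derivative (\<lambda>Y. \<Sum>p | p permutes {..<k}. of_int (sign p) *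
      (\<Sum>a<k. Y $ r a $ c (p a) * (\<Prod>b\<in>{..<k}-{a}. B $ r b $ c (p b))))) (at B)"
proof -
  have entry: "((\<lambda>B. B $ i $ j) has_derivative (\<lambda>Y. Y $ i $ j)) (at B)" for i j and B :: "real^'a^'a"
    by (intro bounded_linear_imp_has_derivative bounded_linear_compose[OF bounded_linear_vec_nth bounded_linear_vec_nth])
  show ?thesis unfolding mn_def
    by (intro has_derivative_sum has_derivative_mult_right has_derivative_prod entry)
qed

text \<open>A permutation other than the identity moves at least two positions. So after the product
  rule removes one factor, an off-diagonal entry of the identity matrix remains and kills the term;
  only \<open>p = id\<close> contributes. The two cases produce the partial traces and the
  off-diagonal entries.\<close>

lemma mn_has_derivative_mat1:
  fixes r c :: "nat \<Rightarrow> 'n::finite"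
  assumes k: "0 < k" and inj: "inj_on c {..<k}" and rc: "\<And>b. 0 < b \<Longrightarrow> b < k \<Longrightarrow> r b = c b"
    and r0: "r 0 = c 0 \<or> r 0 \<notin> c ` {..<k}"
  shows "((\<lambda>B. mn k B r c) has_derivative
    (\<lambda>Y. if r 0 = c 0 then \<Sum>a<k. Y $ c a $ c a else Y $ r 0 $ c 0)) (at (mat 1))"
proof -
  let ?I = "mat 1 :: real^'n^'n"
  have zero: "(\<Prod>b\<in>{..<k}-{a}. ?I $ r b $ c (p b)) = 0"
    if p: "p permutes {..<k}" "p \<noteq> id" and a: "a < k" for p a
  proof -
    have "\<exists>b<k. b \<noteq> a \<and> r b \<noteq> c (p b)"
    proof (rule ccontr)
      assume "\<not> ?thesis"
      then have eq: "r b = c (p b)" if "b < k" "b \<noteq> a" for b using that by blast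
      have pk: "p b < k" if "b < k" for b using permutes_in_image[OF p(1), of b] that by simp
      have fixb: "p b = b" if b: "b < k" "b \<noteq> a" for b
      proof -
        \<comment> \<open>Only position 0 can differ; there \<open>eq\<close> puts
          \<open>r 0\<close> into the range of \<open>c\<close>, which by \<open>r0\<close> leaves
          \<open>r 0 = c 0\<close>.\<close>
        have "r b = c b"
          using rc[of b] r0 eq[OF b] pk[OF b(1)] b by (cases "b = 0") auto
        then have "c (p b) = c b" using eq[OF b] by simp
        then show ?thesis using inj_onD[OF inj] pk b by simp
      qed
      have "p a = a"
      proof (rule ccontr)
        assume "p a \<noteq> a"
        then have "p (p a) = p a" using fixb pk a by blast
        then show False using \<open>p a \<noteq> a\<close> permutes_inj[OF p(1)] by (simp add: inj_eq)
      qed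
      then have "p = id" using fixb p(1) by (auto simp: fun_eq_iff permutes_def)
      then show False using p by simp
    qed
    then show ?thesis by (auto simp: mat_def intro!: prod_zero)
  qed
  \<comment> \<open>If \<open>r 0 \<noteq> c 0\<close>, the factor at position 0 vanishes, so the
    product survives only when exactly that factor is omitted.\<close>
  have prod_id: "(\<Prod>b\<in>{..<k}-{a}. ?I $ r b $ c b) = (if a = 0 \<or> r 0 = c 0 then 1 else 0)" if a: "a < k" for a
  proof (cases "a = 0 \<or> r 0 = c 0")
    case True
    then have "r b = c b" if "b \<in> {..<k} - {a}" for b using rc[of b] that by (cases "b = 0") auto
    then show ?thesis using True by (simp add: mat_def)
  next
    case False
    then have "0 \<in> {..<k} - {a}" "?I $ r 0 $ c 0 = 0" using k by (auto simp: mat_def)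
    then have "(\<Prod>b\<in>{..<k}-{a}. ?I $ r b $ c b) = 0" by (intro prod_zero) auto
    then show ?thesis using False by simp
  qed
  have deriv: "(\<Sum>p | p permutes {..<k}. of_int (sign p) *
      (\<Sum>a<k. Y $ r a $ c (p a) * (\<Prod>b\<in>{..<k}-{a}. ?I $ r b $ c (p b))))
    = (if r 0 = c 0 then \<Sum>a<k. Y $ c a $ c a else Y $ r 0 $ c 0)" (is "?L = ?R") for Y
  proof -
    have "?L = (\<Sum>p | p permutes {..<k}. if p = id then (\<Sum>a<k. Y $ r a $ c a * (\<Prod>b\<in>{..<k}-{a}. ?I $ r b $ c b)) else 0)"
      by (intro sum.cong refl) (auto simp: zero)
    also have "\<dots> = (\<Sum>a<k. Y $ r a $ c a * (\<Prod>b\<in>{..<k}-{a}. ?I $ r b $ c b))"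
      by (simp add: finite_permutations permutes_id)
    also have "\<dots> = (\<Sum>a<k. Y $ r a $ c a * (if a = 0 \<or> r 0 = c 0 then 1 else 0))"
      by (intro sum.cong refl) (simp add: prod_id)
    also have "\<dots> = ?R"
    proof (cases "r 0 = c 0")
      case True
      then have "r a = c a" if "a < k" for a using rc[of a] that by (cases "a = 0") auto
      then show ?thesis using True by simp
    next
      case False
      have "(\<Sum>a<k. Y $ r a $ c a * (if a = 0 \<or> r 0 = c 0 then 1 else 0)) = (\<Sum>a<k. if a = 0 then Y $ r 0 $ c 0 else 0)"
        using False by (intro sum.cong) auto
      then show ?thesis using False k by simp
    qed
    finally show ?thesis .
  qed
  show ?thesis using mn_has_derivative[of k r c ?I] unfolding deriv .
qed

section \<open>Linear functionals arising as differentials of combinations of minors\<close>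

definition lin_comb_minors :: "nat \<Rightarrow> ('n::{finite,linorder} set \<Rightarrow> 'n set \<Rightarrow> real) \<Rightarrow> real^('n::{finite,linorder})^('n::{finite,linorder}) \<Rightarrow> real" where
  "lin_comb_minors k w B = (\<Sum>I\<in>ksubsets k. \<Sum>J\<in>ksubsets k. w I J * minor B I J)"

text \<open>The image of the transpose of the differential of
  \<open>B \<mapsto> ext_power k B\<close> at the identity. It is a subspace of the dual space, and
  it contains all coordinate functionals exactly when that differential is injective; the weights
  \<open>w\<close> then give an explicit left inverse.\<close>

definition minor_differential :: "nat \<Rightarrow> (real^('n::{finite,linorder})^('n::{finite,linorder}) \<Rightarrow> real) \<Rightarrow> bool" where
  "minor_differential k D \<longleftrightarrow>
     (\<exists>w::'n::{finite,linorder} set \<Rightarrow> 'n set \<Rightarrow> real. (lin_comb_minors k w has_derivative D) (at (mat 1)))"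

lemma minor_differential_add:
  assumes "minor_differential k D" "minor_differential k D'"
  shows "minor_differential k (\<lambda>Y. D Y + D' Y)"
proof -
  obtain w w' where "(lin_comb_minors k w has_derivative D) (at (mat 1))" "(lin_comb_minors k w' has_derivative D') (at (mat 1))"
    using assms unfolding minor_differential_def by blast
  then have "((\<lambda>B. lin_comb_minors k w B + lin_comb_minors k w' B) has_derivative (\<lambda>Y. D Y + D' Y)) (at (mat 1))"
    by (rule has_derivative_add)
  moreover have "(\<lambda>B. lin_comb_minors k w B + lin_comb_minors k w' B) = lin_comb_minors k (\<lambda>I J. w I J + w' I J)"
    by (simp add: fun_eq_iff lin_comb_minors_def sum.distrib algebra_simps)
  ultimately show ?thesis unfolding minor_differential_def by metis
qed

lemma minor_differential_scale:
  assumes "minor_differential k D"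
  shows "minor_differential k (\<lambda>Y. a * D Y)"
proof -
  obtain w where "(lin_comb_minors k w has_derivative D) (at (mat 1))"
    using assms unfolding minor_differential_def by blast
  then have "((\<lambda>B. a * lin_comb_minors k w B) has_derivative (\<lambda>Y. a * D Y)) (at (mat 1))"
    by (rule has_derivative_mult_right)
  moreover have "(\<lambda>B. a * lin_comb_minors k w B) = lin_comb_minors k (\<lambda>I J. a * w I J)"
    by (simp add: fun_eq_iff lin_comb_minors_def sum_distrib_left algebra_simps)
  ultimately show ?thesis unfolding minor_differential_def by metis
qed

lemma minor_differential_0: "minor_differential k (\<lambda>Y :: real^('n::{finite,linorder})^('n::{finite,linorder}). 0)"
proof -
  have "lin_comb_minors k (\<lambda>I J. 0) = (\<lambda>B :: ((real, 'n) vec, 'n) vec. 0)"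
    by (simp add: fun_eq_iff lin_comb_minors_def)
  then have "(lin_comb_minors k (\<lambda>I J. 0) has_derivative (\<lambda>Y. 0)) (at (mat 1 :: ((real, 'n) vec, 'n) vec))"
    by simp
  then show ?thesis unfolding minor_differential_def by blast
qed

lemma minor_differential_sum:
  "(\<And>i. i \<in> S \<Longrightarrow> minor_differential k (D i)) \<Longrightarrow> minor_differential k (\<lambda>Y. \<Sum>i\<in>S. D i Y)"
proof (induction S rule: infinite_finite_induct)
  case (insert i S)
  then have "minor_differential k (D i)" "minor_differential k (\<lambda>Y. \<Sum>i\<in>S. D i Y)" by simp_all
  then have "minor_differential k (\<lambda>Y. D i Y + (\<Sum>i\<in>S. D i Y))" by (rule minor_differential_add)
  then show ?case using insert.hyps by simp
qed (simp_all add: minor_differential_0)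

lemma minor_differential_mn:
  assumes "((\<lambda>B. mn k B r c) has_derivative D) (at (mat 1))"
  shows "minor_differential k D"
proof -
  have "(\<lambda>B. mn k B r c) = lin_comb_minors k (\<lambda>I J. mn k (mat 1) r (en I) * mn k (mat 1) (en J) c)"
    by (simp add: fun_eq_iff lin_comb_minors_def mn_eq_sum_minors[symmetric])
  then show ?thesis using assms unfolding minor_differential_def by metis
qed

lemma minor_differential_partial_trace:
  assumes "0 < k" "I \<in> ksubsets k"
  shows "minor_differential k (\<lambda>Y. \<Sum>i\<in>I. Y $ i $ i)"
proof (rule minor_differential_mn)
  have bij: "bij_betw (en I) {..<k} I" by (rule bij_betw_en[OF assms(2)])
  have "(\<lambda>Y. \<Sum>a<k. Y $ en I a $ en I a) = (\<lambda>Y::real^('a::{finite,linorder})^('a::{finite,linorder}). \<Sum>i\<in>I. Y $ i $ i)"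
    using sum.reindex_bij_betw[OF bij] by (intro ext)
  then show "((\<lambda>B. mn k B (en I) (en I)) has_derivative (\<lambda>Y. \<Sum>i\<in>I. Y $ i $ i)) (at (mat 1))"
    using mn_has_derivative_mat1[of k "en I" "en I"] assms bij by (simp add: bij_betw_def)
qed

text \<open>This is the injectivity of the differential of \<open>B \<mapsto> \<Lambda>\<^sup>k B\<close> at the identity, in dual form.\<close>
lemma minor_differential_entry:
  fixes i j :: "'n::{finite,linorder}"
  assumes k: "1 \<le> k" "k < CARD('n)"
  shows "minor_differential k (\<lambda>Y. Y $ i $ j)"
proof (cases "i = j")
  case True
  \<comment> \<open>A \<open>k\<close>-subset avoiding \<open>i\<close> requires
    \<open>k < CARD('n)\<close>.\<close>
  have "k \<le> card (UNIV - {i})" using k by (simp add: card_Diff_singleton)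
  then have "\<exists>I. {} \<subseteq> I \<and> I \<subseteq> UNIV - {i} \<and> card I = k" by (intro ex_ksubset) simp_all
  then obtain I where I: "I \<subseteq> UNIV - {i}" "card I = k" by blast
  have I_k: "I \<in> ksubsets k" and k0: "0 < k" using I k by (auto simp: ksubsets_def)
  note trace_I = minor_differential_partial_trace[OF k0 I_k]
  \<comment> \<open>Exchanging \<open>l\<close> for \<open>i\<close> in \<open>I\<close> changes the
    partial trace by a difference of two diagonal entries.\<close>
  have "minor_differential k (\<lambda>Y. (\<Sum>l\<in>I. Y $ l $ l) + (-1) * (\<Sum>l\<in>insert i (I - {l}). Y $ l $ l))" if "l \<in> I" for l
  proof -
    have "card (insert i (I - {l})) = k" using I that k by (simp add: card_insert_if subset_Diff_insert)
    then have "insert i (I - {l}) \<in> ksubsets k" by (simp add: ksubsets_def)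
    then show ?thesis
      using minor_differential_add[OF trace_I minor_differential_scale[OF minor_differential_partial_trace[OF k0]]]
      by blast
  qed
  moreover have "(\<Sum>l\<in>I. Y $ l $ l) + (-1) * (\<Sum>l\<in>insert i (I - {l}). Y $ l $ l) = Y $ l $ l - Y $ i $ i"
    if "l \<in> I" for l and Y :: "((real, 'n) vec, 'n) vec"
  proof -
    have "i \<notin> I - {l}" using I by auto
    then show ?thesis using that by (simp add: sum.remove[of I l])
  qed
  ultimately have "minor_differential k (\<lambda>Y. Y $ l $ l - Y $ i $ i)" if "l \<in> I" for l
    using that by simp
  \<comment> \<open>Subtracting all these differences from the trace over \<open>I\<close> cancels
    the entries \<open>Y $ l $ l\<close> and leaves \<open>k\<close> copies of
    \<open>Y $ i $ i\<close>.\<close>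
  then have "minor_differential k (\<lambda>Y. (1/k) * ((\<Sum>l\<in>I. Y $ l $ l) + (-1) * (\<Sum>l\<in>I. Y $ l $ l - Y $ i $ i)))"
    by (rule minor_differential_scale[OF minor_differential_add[OF trace_I
          minor_differential_scale[OF minor_differential_sum]]])
  moreover have "(1/k) * ((\<Sum>l\<in>I. Y $ l $ l) + (-1) * (\<Sum>l\<in>I. Y $ l $ l - Y $ i $ i)) = Y $ i $ j"
    for Y :: "((real, 'n) vec, 'n) vec"
    using I k True by (simp add: sum_subtractf)
  ultimately show ?thesis by simp
next
  case False
  then have "card (UNIV - {i, j}) = CARD('n) - 2"
    by (simp add: card_Diff_subset)
  \<comment> \<open>Off the diagonal, rows \<open>i, K\<close> and columns \<open>j, K\<close> with
    a common set \<open>K\<close> of \<open>k - 1\<close> further indices isolate the entry.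
    Position 0 carries \<open>i\<close> and \<open>j\<close>, as
    \<open>mn_has_derivative_mat1\<close> expects.\<close>
  then have "k - 1 \<le> card (UNIV - {i, j})" using k by linarith
  then have "\<exists>K. {} \<subseteq> K \<and> K \<subseteq> UNIV - {i, j} \<and> card K = k - 1" by (intro ex_ksubset) simp_all
  then obtain K where K: "K \<subseteq> UNIV - {i, j}" "card K = k - 1" by blast
  have "card {1..<k} = card K" using K by simp
  then obtain \<kappa> where \<kappa>: "bij_betw \<kappa> {1..<k} K"
    using finite_same_card_bij[of "{1..<k}" K] by auto
  define c where "c b = (if b = 0 then j else \<kappa> b)" for b :: nat
  define r where "r b = (if b = 0 then i else \<kappa> b)" for b :: nat
  have range: "\<kappa> b \<in> K" if "0 < b" "b < k" for b using \<kappa> that by (auto simp: bij_betw_def)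
  have "inj_on c {..<k}"
  proof (rule inj_onI)
    fix a b assume "a \<in> {..<k}" "b \<in> {..<k}" "c a = c b"
    then show "a = b"
      using range[of a] range[of b] K(1) \<kappa> unfolding c_def bij_betw_def
      by (auto split: if_splits dest: inj_onD)
  qed
  moreover have "r 0 \<notin> c ` {..<k}"
  proof
    assume "r 0 \<in> c ` {..<k}"
    then obtain b where "b < k" "r 0 = c b" by auto
    then show False using range[of b] K(1) False unfolding c_def r_def by (auto split: if_splits)
  qed
  ultimately have "((\<lambda>B. mn k B r c) has_derivative (\<lambda>Y. if r 0 = c 0 then \<Sum>a<k. Y $ c a $ c a else Y $ r 0 $ c 0)) (at (mat 1))"
    using k by (intro mn_has_derivative_mat1) (auto simp: r_def c_def)
  then have "((\<lambda>B. mn k B r c) has_derivative (\<lambda>Y. Y $ i $ j)) (at (mat 1))"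
    using False by (simp add: r_def c_def)
  then show ?thesis by (rule minor_differential_mn)
qed

section \<open>Regularity of a matrix function from its minors\<close>

lemma has_derivative_matrixI:
  fixes f :: "'a::real_normed_vector \<Rightarrow> real^'m::finite^'n::finite"
  assumes "\<And>i j. ((\<lambda>x. f x $ i $ j) has_derivative (\<lambda>y. f' y $ i $ j)) (at a)"
  shows "(f has_derivative f') (at a)"
  by (subst has_derivative_componentwise_within) (auto simp: Basis_vec_def inner_axis assms)

text \<open>\<open>H\<close> need not be invertible near \<open>G 0\<close>: the continuity of \<open>G\<close> replaces the inverse function theorem.\<close>
lemma has_vector_derivative_from_image:
  fixes H :: "'a::real_normed_vector \<Rightarrow> 'a" and G :: "real \<Rightarrow> 'a"
  assumes H: "(H has_derivative (\<lambda>y. y)) (at (G 0))" and cont: "isCont G 0"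
    and HG: "((\<lambda>t. H (G t)) has_vector_derivative v) (at 0)"
  shows "(G has_vector_derivative v) (at 0)"
  unfolding has_vector_derivative_def has_derivative_at_alt
proof (intro conjI allI impI)
  show "bounded_linear (\<lambda>t. t *\<^sub>R v)" by (rule bounded_linear_scaleR_left)
  fix e :: real assume e: "0 < e"
  \<comment> \<open>The linearisation error of \<open>H\<close> is at most half of
    \<open>norm \<delta>\<close>, so it is absorbed: \<open>norm \<delta>\<close> is at most twice
    \<open>norm q\<close>, and \<open>norm q\<close> is at most
    \<open>(norm v + 1) * \<bar>t\<bar>\<close>.\<close>
  define C where "C = 2 * (norm v + 1)"
  have C: "C > 0" unfolding C_def by (intro mult_pos_pos add_nonneg_pos) auto
  \<comment> \<open>The tolerance \<open>e\<close> is split evenly: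
    \<open>e1 * C \<le> e / 2\<close> bounds the error of \<open>H\<close>, and \<open>e2\<close>
    below bounds that of \<open>H \<circ> G\<close>.\<close>
  define e1 where "e1 = min (1/2) (e / (2 * C))"
  have e1: "e1 > 0" "e1 \<le> 1/2" "e1 * C \<le> e / 2"
  proof -
    show "e1 > 0" using e C by (simp add: e1_def)
    show "e1 \<le> 1/2" by (simp add: e1_def)
    have "e1 * C \<le> e / (2 * C) * C" unfolding e1_def using C by (intro mult_right_mono) auto
    then show "e1 * C \<le> e / 2" using C by simp
  qed
  define e2 where "e2 = min 1 (e / 2)"
  have e2: "e2 > 0" "e2 \<le> 1" "e2 \<le> e / 2" using e by (auto simp: e2_def)
  obtain d1 where d1: "d1 > 0" "\<And>y. norm (y - G 0) < d1 \<Longrightarrow> norm (H y - H (G 0) - (y - G 0)) \<le> e1 * norm (y - G 0)"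
    using H e1(1) unfolding has_derivative_at_alt by metis
  obtain d2 where d2: "d2 > 0" "\<And>t. norm (t - 0) < d2 \<Longrightarrow> norm (H (G t) - H (G 0) - (t - 0) *\<^sub>R v) \<le> e2 * norm (t - 0)"
    using HG e2(1) unfolding has_vector_derivative_def has_derivative_at_alt by metis
  \<comment> \<open>Continuity alone brings \<open>G t\<close> into the region where
    \<open>H\<close> is nearly the identity; no rate for \<open>G\<close> is known yet.\<close>
  obtain d3 where d3: "d3 > 0" "\<And>t. norm (t - 0) < d3 \<Longrightarrow> norm (G t - G 0) < d1"
    using cont d1(1) unfolding continuous_at_eps_delta dist_norm by metis
  show "\<exists>d>0. \<forall>t. norm (t - 0) < d \<longrightarrow> norm (G t - G 0 - (t - 0) *\<^sub>R v) \<le> e * norm (t - 0)"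
  proof (intro exI[of _ "min d2 d3"] conjI allI impI)
    show "0 < min d2 d3" using d2 d3 by simp
    fix t :: real assume t: "norm (t - 0) < min d2 d3"
    define \<delta> where "\<delta> = G t - G 0"
    define q where "q = H (G t) - H (G 0)"
    have a: "norm (q - \<delta>) \<le> e1 * norm \<delta>"
      using d1(2)[of "G t"] d3(2)[of t] t unfolding q_def \<delta>_def by simp
    have b: "norm (q - t *\<^sub>R v) \<le> e2 * \<bar>t\<bar>" using d2(2)[of t] t unfolding q_def by simp
    have "e1 * norm \<delta> \<le> 1/2 * norm \<delta>" using e1 by (intro mult_right_mono) auto
    moreover have "e2 * \<bar>t\<bar> \<le> 1 * \<bar>t\<bar>" using e2 by (intro mult_right_mono) auto
    moreover have "norm \<delta> \<le> norm q + norm (q - \<delta>)" using norm_triangle_ineq4[of q "q - \<delta>"] by simp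
    moreover have "norm q \<le> norm (t *\<^sub>R v) + norm (q - t *\<^sub>R v)" using norm_triangle_ineq[of "t *\<^sub>R v" "q - t *\<^sub>R v"] by simp
    ultimately have "norm \<delta> \<le> 2 * (\<bar>t\<bar> * norm v + \<bar>t\<bar>)" using a b by simp
    then have "norm \<delta> \<le> C * \<bar>t\<bar>" by (simp add: C_def algebra_simps)
    then have "e1 * norm \<delta> \<le> e1 * (C * \<bar>t\<bar>)" using e1 by (intro mult_left_mono) auto
    also have "\<dots> \<le> e / 2 * \<bar>t\<bar>" using mult_right_mono[OF e1(3), of "\<bar>t\<bar>"] by simp
    finally have "norm (q - \<delta>) \<le> e / 2 * \<bar>t\<bar>" using a by linarith
    moreover have "e2 * \<bar>t\<bar> \<le> e / 2 * \<bar>t\<bar>" using e2 by (intro mult_right_mono) auto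
    moreover have "norm (\<delta> - t *\<^sub>R v) \<le> norm (q - t *\<^sub>R v) + norm (q - \<delta>)"
      using norm_triangle_ineq4[of "q - t *\<^sub>R v" "q - \<delta>"] by simp
    ultimately show "norm (G t - G 0 - (t - 0) *\<^sub>R v) \<le> e * norm (t - 0)"
      using b unfolding \<delta>_def by simp
  qed
qed

section \<open>Determinants, minors and inverses of matrix functions of class
  \<open>ck\<close>\<close>

lemma ck_det:
  fixes A :: "real^'n::finite \<Rightarrow> real^'m::finite^'m"
  assumes "open U" "\<And>i j. ck m U (\<lambda>x. A x $ i $ j)"
  shows "ck m U (\<lambda>x. det (A x))"
  unfolding det_def using assms by (intro ck_sum ck_cmult ck_prod)

lemma ck_minor:
  fixes A :: "real^'n::finite \<Rightarrow> real^('m::{finite,linorder})^('m::{finite,linorder})"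
  assumes "open U" "\<And>i j. ck m U (\<lambda>x. A x $ i $ j)"
  shows "ck m U (\<lambda>x. minor (A x) I J)"
  unfolding minor_def Let_def using assms by (intro ck_sum ck_cmult ck_prod)

lemma matrix_inv_mult:
  fixes A :: "real^'m::finite^'m"
  assumes "det A \<noteq> 0"
  shows "A ** matrix_inv A = mat 1" "matrix_inv A ** A = mat 1"
proof -
  have "\<exists>B. A ** B = mat 1 \<and> B ** A = mat 1"
    using assms by (simp add: invertible_det_nz[symmetric] invertible_def)
  then have "A ** matrix_inv A = mat 1 \<and> matrix_inv A ** A = mat 1"
    unfolding matrix_inv_def by (rule someI_ex)
  then show "A ** matrix_inv A = mat 1" "matrix_inv A ** A = mat 1" by blast+
qed

text \<open>Cramer's rule, applied to the columns of the inverse: the entries become rational in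
  those of \<open>A\<close>, so their regularity follows from that of products and
  reciprocals.\<close>

lemma matrix_inv_entry:
  fixes A :: "real^'m::finite^'m"
  assumes "det A \<noteq> 0"
  shows "matrix_inv A $ l $ c = det (\<chi> i j. if j = l then axis c 1 $ i else A $ i $ j) * inverse (det A)"
proof -
  have "A ** matrix_inv A = mat 1"
    by (rule matrix_inv_mult[OF assms])
  then have "A *v (matrix_inv A *v axis c 1) = axis c 1"
    by (simp add: matrix_vector_mul_assoc)
  then have "matrix_inv A *v axis c 1 = (\<chi> l. det (\<chi> i j. if j = l then axis c 1 $ i else A $ i $ j) / det A)"
    using cramer[OF assms] by blast
  then have "(matrix_inv A *v axis c 1) $ l = det (\<chi> i j. if j = l then axis c 1 $ i else A $ i $ j) * inverse (det A)"
    by (simp add: divide_inverse)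
  then show ?thesis by (simp add: matrix_vector_mult_basis column_def)
qed

lemma ck_matrix_inv:
  fixes A :: "real^'n::finite \<Rightarrow> real^'m::finite^'m"
  assumes U: "open U" and A: "\<And>i j. ck m U (\<lambda>x. A x $ i $ j)" and nz: "\<And>x. x \<in> U \<Longrightarrow> det (A x) \<noteq> 0"
  shows "ck m U (\<lambda>x. matrix_inv (A x) $ l $ c)"
proof -
  have "ck m U (\<lambda>x. (\<chi> i j. if j = l then axis c 1 $ i else A x $ i $ j) $ i $ j)" for i j
    using A U by (cases "j = l") (simp_all add: ck_const)
  then have "ck m U (\<lambda>x. det (\<chi> i j. if j = l then axis c 1 $ i else A x $ i $ j) * inverse (det (A x)))"
    by (intro ck_mult[OF U] ck_det[OF U] ck_inverse[OF U nz] A)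
  then show ?thesis
    by (subst ck_cong[OF U matrix_inv_entry[OF nz]])
qed

text \<open>Translating by the inverse of \<open>g x\<close> moves the linearisation to the
  identity, where the minors determine the matrix to first order. The resulting equation
  \<open>\<partial>_j g = V_j g\<close> has no derivative of \<open>g\<close> on its right side, so
  each order of regularity gives the next.\<close>

theorem smooth_if_minors_smooth:
  fixes g :: "real^'m::finite \<Rightarrow> real^('n::{finite,linorder})^('n::{finite,linorder})"
  assumes op: "open \<Omega>" and k: "1 \<le> k" "k < CARD('n)"
    and cont: "\<And>i j. continuous_on \<Omega> (\<lambda>x. g x $ i $ j)"
    and nz: "\<And>x. x \<in> \<Omega> \<Longrightarrow> det (g x) \<noteq> 0"
    and minors: "\<And>I J. I \<in> ksubsets k \<Longrightarrow> J \<in> ksubsets k \<Longrightarrow> smooth_on \<Omega> (\<lambda>x. minor (g x) I J)"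
  shows "smooth_on \<Omega> (\<lambda>x. g x $ i $ j)"
proof -
  have "\<forall>i j. \<exists>w. (lin_comb_minors k w has_derivative (\<lambda>Y. Y $ i $ j)) (at (mat 1 :: ((real, 'n) vec, 'n) vec))"
    using minor_differential_entry[OF k] unfolding minor_differential_def by blast
  then obtain w where w: "\<And>i j. (lin_comb_minors k (w i j) has_derivative (\<lambda>Y. Y $ i $ j)) (at (mat 1 :: ((real, 'n) vec, 'n) vec))"
    by metis
  \<comment> \<open>\<open>H\<close> is the left inverse of the differential applied to the exterior
    power, so its derivative at the identity is the identity map.\<close>
  define H :: "((real, 'n) vec, 'n) vec \<Rightarrow> ((real, 'n) vec, 'n) vec" where
    "H B = (\<chi> i j. lin_comb_minors k (w i j) B)" for B
  have H: "(H has_derivative (\<lambda>Y. Y)) (at (mat 1))"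
    by (intro has_derivative_matrixI) (simp add: H_def w)
  define P where "P j I L = partial j (\<lambda>x. minor (g x) I L)" for j I L
  \<comment> \<open>\<open>V\<close> is the derivative at \<open>t = 0\<close> of
    \<open>H (g (x + t e_j) ** matrix_inv (g x))\<close>: by Cauchy-Binet the minors of the product
    are linear in those of the first factor, whose derivatives are \<open>P\<close>.\<close>
  define V where "V j i l x = (\<Sum>I\<in>ksubsets k. \<Sum>J\<in>ksubsets k. w i l I J *
    (\<Sum>L\<in>ksubsets k. P j I L x * minor (matrix_inv (g x)) L J))" for j i l x
  define D where "D j i l x = (\<Sum>q\<in>UNIV. V j i q x * g x $ q $ l)" for j i l x
  have P_ck: "ck m \<Omega> (P j I L)" if "I \<in> ksubsets k" "L \<in> ksubsets k" for m j I L
    using minors[OF that] smooth_on_partial unfolding P_def smooth_on_iff_ck by blast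
  have line_deriv: "((\<lambda>t. minor (g (x + t *\<^sub>R axis j 1)) I L) has_real_derivative P j I L x) (at 0)"
    if "I \<in> ksubsets k" "L \<in> ksubsets k" "x \<in> \<Omega>" for j I L x
    using minors[OF that(1,2)] ck_SucD[of 0 \<Omega> "\<lambda>x. minor (g x) I L" x j] that(3) unfolding P_def smooth_on_iff_ck by blast
  have deriv: "((\<lambda>t. g (x + t *\<^sub>R axis j 1) $ i $ l) has_real_derivative D j i l x) (at 0)" if x: "x \<in> \<Omega>" for j i l x
  proof -
    let ?U = "matrix_inv (g x)"
    define G where "G t = g (x + t *\<^sub>R axis j 1) ** ?U" for t
    have inv: "g x ** ?U = mat 1" "?U ** g x = mat 1"
      by (rule matrix_inv_mult[OF nz[OF x]])+
    have contg: "isCont (\<lambda>t. g (x + t *\<^sub>R axis j 1) $ i $ l) 0" for i l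
    proof -
      have "isCont (\<lambda>x. g x $ i $ l) (x + 0 *\<^sub>R axis j 1)"
        using cont[of i l] op x by (simp add: continuous_on_eq_continuous_at)
      moreover have "isCont (\<lambda>t. x + t *\<^sub>R axis j 1) 0" by (intro continuous_intros)
      ultimately show ?thesis
        using isCont_o2[of 0 "\<lambda>t. x + t *\<^sub>R axis j 1" "\<lambda>x. g x $ i $ l"] by simp
    qed
    have contG: "isCont G 0"
      unfolding isCont_def G_def matrix_matrix_mult_def
      by (intro tendsto_vec_lambda tendsto_sum tendsto_mult tendsto_const contg[unfolded isCont_def])
    have G0: "G 0 = mat 1" by (simp add: G_def inv)
    have "((\<lambda>t. lin_comb_minors k (w i l) (G t)) has_real_derivative V j i l x) (at 0)" for i l
    proof -
      have eq: "lin_comb_minors k (w i l) (G t) = (\<Sum>I\<in>ksubsets k. \<Sum>J\<in>ksubsets k. w i l I J *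
        (\<Sum>L\<in>ksubsets k. minor (g (x + t *\<^sub>R axis j 1)) I L * minor ?U L J))" for t
        unfolding lin_comb_minors_def G_def by (intro sum.cong refl) (simp add: minor_mult)
      show ?thesis unfolding eq V_def
        by (intro DERIV_sum DERIV_cmult DERIV_cmult_right line_deriv x)
    qed
    then have "((\<lambda>t. lin_comb_minors k (w i l) (G t)) has_derivative (\<lambda>t. t * V j i l x)) (at 0)" for i l
      unfolding has_field_derivative_def by (rule has_derivative_eq_rhs) (simp add: fun_eq_iff)
    then have "((\<lambda>t. H (G t)) has_vector_derivative (\<chi> i l. V j i l x)) (at 0)"
      unfolding has_vector_derivative_def
      by (intro has_derivative_matrixI) (simp add: H_def)
    then have "(G has_vector_derivative (\<chi> i l. V j i l x)) (at 0)"
      by (rule has_vector_derivative_from_image[of H, rotated 2]) (simp_all add: H contG G0)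
    then have "(G has_derivative (\<lambda>t. t *\<^sub>R (\<chi> i l. V j i l x))) (at 0)"
      by (simp add: has_vector_derivative_def)
    from has_derivative_compose[OF this bounded_linear_imp_has_derivative[OF
        bounded_linear_compose[OF bounded_linear_vec_nth bounded_linear_vec_nth]]]
    have "((\<lambda>t. G t $ i $ q) has_derivative (\<lambda>t. (t *\<^sub>R (\<chi> i l. V j i l x)) $ i $ q)) (at 0)" for i q .
    then have dG: "((\<lambda>t. G t $ i $ q) has_real_derivative V j i q x) (at 0)" for i q
      unfolding has_field_derivative_def by (rule has_derivative_eq_rhs) (simp add: fun_eq_iff)
    \<comment> \<open>The translation is undone, which turns the derivative \<open>V\<close> of
      \<open>G\<close> into \<open>D\<close>, the product of \<open>V\<close> and
      \<open>g x\<close>.\<close>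
    have "g (x + t *\<^sub>R axis j 1) = G t ** g x" for t
      by (simp add: G_def matrix_mul_assoc[symmetric] inv)
    then have "g (x + t *\<^sub>R axis j 1) $ i $ l = (\<Sum>q\<in>UNIV. G t $ i $ q * g x $ q $ l)" for t
      by (simp add: matrix_matrix_mult_def)
    then show ?thesis unfolding D_def by (simp add: DERIV_sum DERIV_cmult_right dG)
  qed
  have "\<forall>i l. ck m \<Omega> (\<lambda>x. g x $ i $ l)" for m
  proof (induction m)
    case 0 then show ?case using cont by simp
  next
    case (Suc m)
    have g: "ck m \<Omega> (\<lambda>x. g x $ i $ l)" for i l using Suc.IH by blast
    have inv: "ck m \<Omega> (\<lambda>x. minor (matrix_inv (g x)) L J)" for L J
      by (intro ck_minor ck_matrix_inv op g nz)
    \<comment> \<open>\<open>P\<close> is smooth to all orders and the inverse of \<open>g\<close>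
      inherits order \<open>m\<close>, so \<open>D\<close> has order \<open>m\<close> although it is
      the derivative of \<open>g\<close>.\<close>
    have "ck m \<Omega> (V j i l)" for j i l
      unfolding V_def by (intro ck_sum ck_cmult ck_mult op P_ck inv)
    then have "ck m \<Omega> (D j i l)" for j i l
      unfolding D_def by (intro ck_sum ck_mult op g)
    then have "ck (Suc m) \<Omega> (\<lambda>x. g x $ i $ l)" for i l
      by (intro ck_SucI[where D="\<lambda>j. D j i l"] op cont deriv)
    then show ?case by blast
  qed
  then show ?thesis unfolding smooth_on_iff_ck by blast
qed

section \<open>Mollifiers\<close>

text \<open>The set where \<open>w\<close> differs from \<open>c\<close> within \<open>U\<close> is
  open, and a nonempty open set is not null.\<close>

lemma continuous_AE_zero:
  fixes w :: "'a::euclidean_space \<Rightarrow> 'b::t1_space"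
  assumes "open U" "continuous_on U w" "AE x in lborel. x \<in> U \<longrightarrow> w x = c" "x \<in> U"
  shows "w x = c"
proof (rule ccontr)
  assume "w x \<noteq> c"
  let ?N = "U \<inter> w -` (- {c})"
  have op: "open ?N" using assms(1,2) by (intro continuous_open_preimage) auto
  have "x \<in> ?N" using assms(4) \<open>w x \<noteq> c\<close> by auto
  have "AE x in lebesgue. x \<in> U \<longrightarrow> w x = c"
    using assms(3) by (rule AE_completion)
  then have "AE x in lebesgue. x \<notin> ?N" by (rule AE_mp) auto
  moreover have "?N \<in> sets lebesgue" using op by simp
  ultimately have "?N \<in> null_sets lebesgue" by (subst AE_iff_null_sets)
  then show False using open_not_negligible[OF op] \<open>x \<in> ?N\<close> by (auto simp: negligible_iff_null_sets)
qed

text \<open>\<open>flat 1\<close> is the classical function \<open>exp (-1/t)\<close>, flat at 0.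
  Polynomial factors in \<open>1/t\<close> make the family closed under differentiation.\<close>

definition flat :: "real poly \<Rightarrow> real \<Rightarrow> real" where
  "flat p t = (if t > 0 then poly p (inverse t) * exp (- inverse t) else 0)"

lemma poly_times_exp_neg_tendsto_0: "((\<lambda>s. poly p s * exp (- s)) \<longlongrightarrow> 0) (at_top :: real filter)"
proof -
  have "((\<lambda>s. \<Sum>i\<le>degree p. coeff p i * (s ^ i / exp s)) \<longlongrightarrow> (\<Sum>i\<le>degree p. coeff p i * 0)) (at_top :: real filter)"
    by (intro tendsto_sum tendsto_mult tendsto_const tendsto_power_div_exp_0)
  then show ?thesis
    by (simp add: poly_altdef sum_distrib_right exp_minus divide_inverse mult.assoc)
qed

text \<open>With \<open>s = 1/t\<close> one has \<open>s' = - s^2\<close>, so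
  \<open>p(s) exp(-s)\<close> has derivative \<open>s^2 (p(s) - p'(s)) exp(-s)\<close>; the
  polynomial \<open>[:0, 0, 1:]\<close> is \<open>s^2\<close>.\<close>

lemma flat_has_real_derivative:
  "(flat p has_real_derivative flat ([:0, 0, 1:] * (p - pderiv p)) t) (at t)"
proof -
  consider "t > 0" | "t < 0" | "t = 0" by linarith
  then show ?thesis
  proof cases
    case 1
    have "((\<lambda>t. poly p (inverse t) * exp (- inverse t)) has_real_derivative
       (poly (pderiv p) (inverse t) * (- (inverse t * inverse t))) * exp (- inverse t) + (exp (- inverse t) * (inverse t * inverse t)) * poly p (inverse t)) (at t)"
      using 1 by (auto intro!: derivative_eq_intros DERIV_chain'[OF _ poly_DERIV] simp: power2_eq_square algebra_simps)
    then have "((\<lambda>t. poly p (inverse t) * exp (- inverse t)) has_real_derivative flat ([:0, 0, 1:] * (p - pderiv p)) t) (at t)"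
      by (rule DERIV_cong) (use 1 in \<open>simp add: flat_def algebra_simps\<close>)
    then show ?thesis
      by (rule has_field_derivative_transform_within_open[of _ _ _ "{0<..}"]) (use 1 in \<open>auto simp: flat_def\<close>)
  next
    case 2
    have "((\<lambda>t. 0) has_real_derivative flat ([:0, 0, 1:] * (p - pderiv p)) t) (at t)"
      using 2 by (simp add: flat_def)
    then show ?thesis
      by (rule has_field_derivative_transform_within_open[of _ _ _ "{..<0}"]) (use 2 in \<open>auto simp: flat_def\<close>)
  next
    case 3
    \<comment> \<open>Dividing by \<open>h\<close> multiplies the polynomial by \<open>1/h\<close>,
      so the difference quotient at 0 is again of the decaying form.\<close>
    have "((\<lambda>h. poly ([:0, 1:] * p) (inverse h) * exp (- inverse h)) \<longlongrightarrow> 0) (at_right (0::real))"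
      by (rule filterlim_compose[OF poly_times_exp_neg_tendsto_0 filterlim_inverse_at_top_right])
    then have r: "((\<lambda>h. flat p h / h) \<longlongrightarrow> 0) (at_right 0)"
      by (rule Lim_transform_eventually)
        (rule eventually_mono[OF eventually_at_right_less[of 0]], simp add: flat_def divide_inverse)
    have l: "((\<lambda>h. flat p h / h) \<longlongrightarrow> 0) (at_left 0)"
      by (rule Lim_transform_eventually[OF tendsto_const])
        (rule eventually_at_leftI[of "-1"], simp_all add: flat_def)
    have "((\<lambda>h. flat p h / h) \<longlongrightarrow> 0) (at 0)" using l r by (rule filterlim_split_at)
    then show ?thesis unfolding 3 by (simp add: DERIV_def flat_def)
  qed
qed

lemma continuous_on_flat: "continuous_on UNIV (\<lambda>x :: real^'n::finite. flat p (a + b * x $ i))"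
proof (rule continuous_on_compose2[where g="flat p" and t=UNIV])
  show "continuous_on UNIV (flat p)"
    using DERIV_isCont[OF flat_has_real_derivative] by (simp add: continuous_at_imp_continuous_on)
  show "continuous_on UNIV (\<lambda>x :: real^'n. a + b * x $ i)"
    by (intro continuous_on_add continuous_on_mult continuous_on_const continuous_on_component continuous_on_id)
qed simp

lemma ck_flat: "ck m UNIV (\<lambda>x :: real^'n::finite. flat p (a + b * x $ i))"
proof (induction m arbitrary: p)
  case 0
  show ?case by (simp add: continuous_on_flat)
next
  case (Suc m)
  let ?q = "[:0, 0, 1:] * (p - pderiv p)"
  show ?case
  proof (rule ck_SucI[where D="\<lambda>j x. (if j = i then b else 0) * flat ?q (a + b * x $ i)"])
    show "continuous_on UNIV (\<lambda>x :: real^'n. flat p (a + b * x $ i))"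
      by (rule continuous_on_flat)
    show "((\<lambda>t. flat p (a + b * (x + t *\<^sub>R axis j 1) $ i)) has_real_derivative
      (if j = i then b else 0) * flat ?q (a + b * x $ i)) (at 0)" for j and x :: "real^'n"
    proof -
      have "((\<lambda>t. a + b * (x + t *\<^sub>R axis j 1) $ i) has_real_derivative (if j = i then b else 0)) (at 0)"
        by (auto intro!: derivative_eq_intros simp: axis_def)
      from DERIV_chain2[OF flat_has_real_derivative this] show ?thesis by (simp add: mult.commute)
    qed
    show "ck m UNIV (\<lambda>x :: real^'n. (if j = i then b else 0) * flat ?q (a + b * x $ i))" for j
      by (intro ck_cmult Suc.IH open_UNIV)
  qed simp
qed

lemma ex_mollifier:
  assumes "\<epsilon> > 0"
  shows "\<exists>\<eta> :: real^'n::finite \<Rightarrow> real. smooth_on UNIV \<eta> \<and> (\<forall>x. 0 \<le> \<eta> x) \<and> (\<forall>x. \<epsilon> < norm x \<longrightarrow> \<eta> x = 0)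
    \<and> integrable lborel \<eta> \<and> integral\<^sup>L lborel \<eta> = 1"
proof -
  \<comment> \<open>The bump lives where all coordinates are below \<open>\<delta>\<close> in
    absolute value; comparing the norm with the sum of the coordinates then gives the bound
    \<open>\<epsilon>\<close>.\<close>
  define \<delta> where "\<delta> = \<epsilon> / CARD('n)"
  have \<delta>: "\<delta> > 0" using assms by (simp add: \<delta>_def)
  define b :: "real^'n \<Rightarrow> real" where "b x = (\<Prod>i\<in>UNIV. flat 1 (\<delta> + 1 * x $ i) * flat 1 (\<delta> + (-1) * x $ i))" for x
  have ck: "ck m UNIV b" for m
    unfolding b_def by (intro ck_prod ck_mult ck_flat open_UNIV)
  have nonneg: "0 \<le> b x" for x
    unfolding b_def flat_def by (intro prod_nonneg) auto
  have zero: "b x = 0" if "\<epsilon> < norm x" for x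
  proof -
    have "\<exists>i. \<delta> \<le> \<bar>x $ i\<bar>"
    proof (rule ccontr)
      assume "\<not> ?thesis"
      then have "norm x \<le> (\<Sum>i\<in>(UNIV::'n set). \<delta>)"
        by (intro order_trans[OF norm_le_l1_cart] sum_mono) (auto simp: not_le less_imp_le)
      then show False using that by (simp add: \<delta>_def)
    qed
    then obtain i where "\<delta> \<le> \<bar>x $ i\<bar>" ..
    then have "flat 1 (\<delta> + 1 * x $ i) * flat 1 (\<delta> + (-1) * x $ i) = 0" by (auto simp: flat_def)
    then show ?thesis unfolding b_def by (intro prod_zero) auto
  qed
  have cont: "continuous_on UNIV b" using ck[of 0] by simp
  have "integrable lborel (\<lambda>x. indicator (cball 0 \<epsilon>) x *\<^sub>R b x)"
    by (rule borel_integrable_compact) (auto intro: continuous_on_subset[OF cont])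
  moreover have "(\<lambda>x. indicator (cball 0 \<epsilon>) x *\<^sub>R b x) = b"
    using zero by (auto simp: fun_eq_iff indicator_def not_le)
  ultimately have int: "integrable lborel b" by simp
  \<comment> \<open>Needed for normalisation: a continuous nonnegative function that is positive at
    a point has positive integral.\<close>
  have "b 0 \<noteq> 0" using \<delta> by (simp add: b_def flat_def)
  then have "\<not> (AE x in lborel. b x = 0)"
    using continuous_AE_zero[OF open_UNIV cont, of 0 0] by auto
  then have "integral\<^sup>L lborel b \<noteq> 0"
    using integral_nonneg_eq_0_iff_AE[OF int] nonneg by auto
  moreover have "integral\<^sup>L lborel b \<ge> 0" using nonneg by (intro Bochner_Integration.integral_nonneg) auto
  ultimately have pos: "integral\<^sup>L lborel b > 0" by linarith
  have "smooth_on UNIV (\<lambda>x. inverse (integral\<^sup>L lborel b) * b x)"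
    unfolding smooth_on_iff_ck by (intro allI ck_cmult ck open_UNIV)
  then show ?thesis
    using pos nonneg zero int by (intro exI[of _ "\<lambda>x. inverse (integral\<^sup>L lborel b) * b x"]) auto
qed

section \<open>Preliminaries on integrals and partial derivatives\<close>

lemma lborel_distr_reflect:
  "distr lborel borel (\<lambda>y. x - y) = (lborel :: 'a::euclidean_space measure)"
  using lborel_affine[of "-1" x] by (simp add: density_1)

lemma
  fixes \<eta> :: "'a::euclidean_space \<Rightarrow> real"
  assumes "integrable lborel \<eta>"
  shows integrable_lborel_reflect: "integrable lborel (\<lambda>y. \<eta> (x - y))"
    and integral_lborel_reflect: "(\<integral>y. \<eta> (x - y) \<partial>lborel) = integral\<^sup>L lborel \<eta>"
    and integrable_lborel_shift: "integrable lborel (\<lambda>y. \<eta> (y - x))"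
    and integral_lborel_shift: "(\<integral>y. \<eta> (y - x) \<partial>lborel) = integral\<^sup>L lborel \<eta>"
proof -
  have [measurable]: "\<eta> \<in> borel_measurable borel" using assms by (auto dest: borel_measurable_integrable)
  have "integrable (distr lborel borel (\<lambda>y. x - y)) \<eta>" using assms by (simp add: lborel_distr_reflect)
  then show "integrable lborel (\<lambda>y. \<eta> (x - y))" by (subst (asm) integrable_distr_eq) auto
  have "integral\<^sup>L (distr lborel borel (\<lambda>y. x - y)) \<eta> = (\<integral>y. \<eta> (x - y) \<partial>lborel)" by (rule integral_distr) auto
  then show "(\<integral>y. \<eta> (x - y) \<partial>lborel) = integral\<^sup>L lborel \<eta>" by (simp add: lborel_distr_reflect)
  have "integrable (distr lborel borel ((+) (- x))) \<eta>" using assms by (simp add: lborel_distr_plus)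
  then show "integrable lborel (\<lambda>y. \<eta> (y - x))" by (subst (asm) integrable_distr_eq) auto
  have "integral\<^sup>L (distr lborel borel ((+) (- x))) \<eta> = (\<integral>y. \<eta> (- x + y) \<partial>lborel)" by (rule integral_distr) auto
  then show "(\<integral>y. \<eta> (y - x) \<partial>lborel) = integral\<^sup>L lborel \<eta>" by (simp add: lborel_distr_plus)
qed

text \<open>The positive and negative parts of \<open>w\<close> are densities of two measures that
  agree on boxes. Boxes are stable under intersection and generate the Borel sets, so the measures
  agree, and hence so do the densities almost everywhere.\<close>

lemma AE_zero_if_box_integrals_zero:
  fixes w :: "'a::euclidean_space \<Rightarrow> real"
  assumes w: "integrable lborel w" and zero: "\<And>a b. (\<integral>x. indicator (box a b) x * w x \<partial>lborel) = 0"
  shows "AE x in lborel. w x = 0"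
proof -
  have [measurable]: "w \<in> borel_measurable borel" using w by (auto dest: borel_measurable_integrable)
  \<comment> \<open>\<open>ennreal\<close> sends negative reals to 0, so these are the positive and
    the negative part.\<close>
  let ?p = "\<lambda>x. ennreal (w x)" and ?m = "\<lambda>x. ennreal (- w x)"
  have ind_int: "integrable lborel (\<lambda>x. indicator (box a b) x * u x)" if "integrable lborel u" for u :: "'a \<Rightarrow> real" and a b
    using integrable_mult_indicator[of "box a b" lborel u] that by simp
  have emb: "emeasure (density lborel (\<lambda>x. ennreal (v x))) (box a b) = ennreal (\<integral>x. indicator (box a b) x * max 0 (v x) \<partial>lborel)"
    if v: "integrable lborel v" for v :: "'a \<Rightarrow> real" and a b
  proof -
    have [measurable]: "v \<in> borel_measurable borel" using v by (auto dest: borel_measurable_integrable)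
    have "emeasure (density lborel (\<lambda>x. ennreal (v x))) (box a b) = (\<integral>\<^sup>+ x. ennreal (indicator (box a b) x * max 0 (v x)) \<partial>lborel)"
      by (subst emeasure_density) (auto intro!: nn_integral_cong simp: indicator_def max_def ennreal_neg)
    also have "\<dots> = ennreal (\<integral>x. indicator (box a b) x * max 0 (v x) \<partial>lborel)"
      by (intro nn_integral_eq_integral ind_int integrable_max integrable_zero v) (simp add: indicator_def)
    finally show ?thesis .
  qed
  have eqb: "(\<integral>x. indicator (box a b) x * max 0 (w x) \<partial>lborel) = (\<integral>x. indicator (box a b) x * max 0 (- w x) \<partial>lborel)" for a b
  proof -
    have "integrable lborel (\<lambda>x. indicator (box a b) x * max 0 (w x))" "integrable lborel (\<lambda>x. indicator (box a b) x * max 0 (- w x))"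
      by (intro ind_int integrable_max integrable_zero integrable_minus w)+
    note diff = Bochner_Integration.integral_diff[OF this]
    have eq: "indicator (box a b) x * max 0 (w x) - indicator (box a b) x * max 0 (- w x) = indicator (box a b) x * w x" for x
      by (simp add: max_def indicator_def)
    from diff
    have "(\<integral>x. indicator (box a b) x * max 0 (w x) \<partial>lborel) - (\<integral>x. indicator (box a b) x * max 0 (- w x) \<partial>lborel)
      = (\<integral>x. indicator (box a b) x * w x \<partial>lborel)"
      by (simp add: eq)
    then show ?thesis using zero by simp
  qed
  have "density lborel ?p = density lborel ?m"
  proof (rule measure_eqI_generator_eq[where \<Omega>=UNIV and E="range (\<lambda>(a, b). box a b)" and A="\<lambda>n. box (- (real n *\<^sub>R One)) (real n *\<^sub>R One)"])
    show "Int_stable (range (\<lambda>(a, b). box a b :: 'a set))"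
      by (auto simp: Int_stable_def box_Int_box)
    show "emeasure (density lborel ?p) X = emeasure (density lborel ?m) X" if "X \<in> range (\<lambda>(a, b). box a b)" for X
      using that emb[of w] emb[of "\<lambda>x. - w x"] w eqb by auto
    show "emeasure (density lborel ?p) (box (- (real i *\<^sub>R One)) (real i *\<^sub>R One)) \<noteq> \<infinity>" for i
      using emb[OF w] by simp
  qed (auto simp: borel_eq_box UN_box_eq_UNIV)
  then have "AE x in lborel. ?p x = ?m x"
    by (intro sigma_finite_measure.density_unique[OF sigma_finite_lborel]) auto
  then show ?thesis
  proof eventually_elim
    fix x assume eq: "ennreal (w x) = ennreal (- w x)"
    show "w x = 0"
    proof (cases "w x \<ge> 0")
      case True
      then have "ennreal (- w x) = 0" by (simp add: ennreal_neg)
      then show ?thesis using eq True by simp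
    next
      case False
      then have "ennreal (w x) = 0" by (simp add: ennreal_neg)
      then have "ennreal (- w x) = 0" using eq by simp
      then show ?thesis using False by (simp add: ennreal_eq_0_iff)
    qed
  qed
qed

text \<open>The mean value bound is applied to one coordinate at a time. The intermediate points
  \<open>hyb S\<close> mix coordinates of \<open>x\<close> and \<open>y\<close> and stay inside
  because the domain is a box; existence of partial derivatives is enough.\<close>

lemma partials_bounded_imp_lipschitz_on_box:
  fixes F :: "real^'n::finite \<Rightarrow> real"
  assumes x: "x \<in> box a b" and y: "y \<in> box a b"
    and D: "\<And>z j. z \<in> box a b \<Longrightarrow> ((\<lambda>t. F (z + t *\<^sub>R axis j 1)) has_real_derivative D j z) (at 0)"
    and C: "\<And>z j. z \<in> box a b \<Longrightarrow> \<bar>D j z\<bar> \<le> C"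
  shows "\<bar>F y - F x\<bar> \<le> C * (\<Sum>i\<in>UNIV. \<bar>y $ i - x $ i\<bar>)"
proof -
  define hyb where "hyb S = (\<chi> i. if i \<in> S then y $ i else x $ i)" for S
  have hyb: "hyb S \<in> box a b" for S
    using x y by (auto simp: hyb_def mem_box_cart)
  have "\<bar>F (hyb S) - F x\<bar> \<le> C * (\<Sum>i\<in>S. \<bar>y $ i - x $ i\<bar>)" if "finite S" for S
    using that
  proof induction
    case empty
    have "hyb {} = x" by (simp add: hyb_def)
    then show ?case by simp
  next
    case (insert j S)
    let ?d = "y $ j - x $ j" and ?z = "hyb S"
    have step: "hyb (insert j S) = ?z + ?d *\<^sub>R axis j 1"
      using insert.hyps by (auto simp: vec_eq_iff hyb_def axis_def)
    have line: "?z + t *\<^sub>R axis j 1 \<in> box a b" if t: "t \<in> closed_segment 0 ?d" for t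
    proof -
      have "?z \<in> box a b" "?z + ?d *\<^sub>R axis j 1 \<in> box a b" using hyb step by metis+
      then have "closed_segment ?z (?z + ?d *\<^sub>R axis j 1) \<subseteq> box a b"
        by (simp add: closed_segment_subset)
      moreover obtain u where u: "0 \<le> u" "u \<le> 1" "t = u * ?d"
        using t unfolding in_segment by auto
      have "?z + t *\<^sub>R axis j 1 = (1 - u) *\<^sub>R ?z + u *\<^sub>R (?z + ?d *\<^sub>R axis j 1)"
        unfolding u(3) by (simp add: algebra_simps)
      then have "?z + t *\<^sub>R axis j 1 \<in> closed_segment ?z (?z + ?d *\<^sub>R axis j 1)"
        using u unfolding in_segment by blast
      ultimately show ?thesis by blast
    qed
    have "norm ((\<lambda>t. F (?z + t *\<^sub>R axis j 1)) ?d - (\<lambda>t. F (?z + t *\<^sub>R axis j 1)) 0) \<le> C * norm (?d - 0)"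
    proof (rule field_differentiable_bound[where S="closed_segment 0 ?d" and f'="\<lambda>t. D j (?z + t *\<^sub>R axis j 1)"])
      fix t assume t: "t \<in> closed_segment 0 ?d"
      have "((\<lambda>s. F (?z + t *\<^sub>R axis j 1 + s *\<^sub>R axis j 1)) has_real_derivative D j (?z + t *\<^sub>R axis j 1)) (at 0)"
        by (rule D[OF line[OF t]])
      then have "((\<lambda>s. F (?z + (s + t) *\<^sub>R axis j 1)) has_real_derivative D j (?z + t *\<^sub>R axis j 1)) (at 0)"
        by (simp add: scaleR_left_distrib add_ac)
      then have "((\<lambda>s. F (?z + s *\<^sub>R axis j 1)) has_real_derivative D j (?z + t *\<^sub>R axis j 1)) (at (0 + t))"
        by (subst DERIV_shift)
      then show "((\<lambda>t. F (?z + t *\<^sub>R axis j 1)) has_real_derivative D j (?z + t *\<^sub>R axis j 1)) (at t within closed_segment 0 ?d)"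
        by (simp add: has_field_derivative_at_within)
      show "norm (D j (?z + t *\<^sub>R axis j 1)) \<le> C" using C[OF line[OF t]] by simp
    qed auto
    then have "\<bar>F (hyb (insert j S)) - F ?z\<bar> \<le> C * \<bar>?d\<bar>" by (simp add: step)
    then show ?case using insert by (simp add: algebra_simps)
  qed
  from this[of UNIV] show ?thesis by (simp add: hyb_def)
qed

section \<open>Convolution\<close>

lemma integrable_mult_bounded:
  fixes v \<eta> :: "'a::euclidean_space \<Rightarrow> real"
  assumes v: "integrable lborel v" and "\<eta> \<in> borel_measurable borel" "\<And>z. \<bar>\<eta> z\<bar> \<le> B"
  shows "integrable lborel (\<lambda>y. v y * \<eta> y)"
proof (rule Bochner_Integration.integrable_bound)
  have [measurable]: "v \<in> borel_measurable borel" "\<eta> \<in> borel_measurable borel"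
    using assms by (auto dest: borel_measurable_integrable)
  show "integrable lborel (\<lambda>y. B * v y)" using v by simp
  show "(\<lambda>y. v y * \<eta> y) \<in> borel_measurable lborel" by measurable
  have "\<bar>v y * \<eta> y\<bar> \<le> \<bar>B * v y\<bar>" for y
  proof -
    have "\<bar>\<eta> y\<bar> \<le> \<bar>B\<bar>" using assms(3)[of y] by linarith
    then show ?thesis by (simp add: abs_mult mult.commute mult_right_mono)
  qed
  then show "AE y in lborel. norm (v y * \<eta> y) \<le> norm (B * v y)" by simp
qed

lemma bounded_if_zero_outside_cball:
  fixes f :: "'a::euclidean_space \<Rightarrow> real"
  assumes "continuous_on UNIV f" "\<And>z. \<epsilon> < norm z \<Longrightarrow> f z = 0"
  shows "\<exists>B. \<forall>z. \<bar>f z\<bar> \<le> B"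
proof -
  have "compact (f ` cball 0 \<epsilon>)"
    using assms(1) by (intro compact_continuous_image) (auto intro: continuous_on_subset)
  then obtain B where B: "\<And>y. y \<in> f ` cball 0 \<epsilon> \<Longrightarrow> norm y \<le> B"
    using compact_imp_bounded bounded_iff by metis
  have "\<bar>f z\<bar> \<le> max 0 B" for z
  proof (cases "\<epsilon> < norm z")
    case True then show ?thesis using assms(2) by simp
  next
    case False
    then have "norm (f z) \<le> B" by (intro B imageI) simp
    then show ?thesis by simp
  qed
  then show ?thesis by blast
qed

lemma partial_zero_outside_cball:
  fixes f :: "real^'n::finite \<Rightarrow> real"
  assumes "\<And>z. \<epsilon> < norm z \<Longrightarrow> f z = 0" "\<epsilon> < norm z"
  shows "partial j f z = 0"
proof -
  have "partial j f z = partial j (\<lambda>_. 0) z"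
    by (rule partial_cong[of "- cball 0 \<epsilon>"]) (use assms in \<open>auto simp: not_le\<close>)
  then show ?thesis by (simp add: partial_def)
qed

text \<open>Dominated convergence: the mean value bound keeps the difference quotients of
  \<open>\<eta>\<close> below \<open>B\<close>, so \<open>B * \<bar>v y\<bar>\<close> dominates. The
  derivative falls on \<open>\<eta>\<close>, and \<open>v\<close> need only be integrable.\<close>

lemma DERIV_convolution:
  fixes v \<eta> :: "real^'n::finite \<Rightarrow> real"
  assumes v: "integrable lborel v" and \<eta>: "ck (Suc 0) UNIV \<eta>"
    and B: "\<And>z. \<bar>\<eta> z\<bar> \<le> B" "\<And>z. \<bar>partial j \<eta> z\<bar> \<le> B"
  shows "((\<lambda>t. \<integral>y. v y * \<eta> (x + t *\<^sub>R axis j 1 - y) \<partial>lborel) has_real_derivative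
     (\<integral>y. v y * partial j \<eta> (x - y) \<partial>lborel)) (at 0)"
proof -
  have c: "continuous_on UNIV \<eta>" "continuous_on UNIV (partial j \<eta>)"
    using \<eta> by simp_all
  have [measurable]: "v \<in> borel_measurable borel" "\<eta> \<in> borel_measurable borel" "partial j \<eta> \<in> borel_measurable borel"
    using v c by (auto dest: borel_measurable_integrable intro: borel_measurable_continuous_onI)
  have D: "((\<lambda>t. \<eta> (z + t *\<^sub>R axis j 1)) has_real_derivative partial j \<eta> z) (at 0)" for z
    using ck_SucD[OF \<eta>, of z j] by simp
  have D': "((\<lambda>t. \<eta> (z + t *\<^sub>R axis j 1)) has_real_derivative partial j \<eta> (z + t *\<^sub>R axis j 1)) (at t)" for z t
  proof -
    have "((\<lambda>s. \<eta> (z + (s + t) *\<^sub>R axis j 1)) has_real_derivative partial j \<eta> (z + t *\<^sub>R axis j 1)) (at 0)"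
      using D[of "z + t *\<^sub>R axis j 1"] by (simp add: scaleR_left_distrib add_ac)
    then have "((\<lambda>t. \<eta> (z + t *\<^sub>R axis j 1)) has_real_derivative partial j \<eta> (z + t *\<^sub>R axis j 1)) (at (0 + t))"
      by (subst DERIV_shift)
    then show ?thesis by simp
  qed
  have lip: "\<bar>\<eta> (z + t *\<^sub>R axis j 1) - \<eta> z\<bar> \<le> B * \<bar>t\<bar>" for z t
  proof -
    have "norm ((\<lambda>t. \<eta> (z + t *\<^sub>R axis j 1)) t - (\<lambda>t. \<eta> (z + t *\<^sub>R axis j 1)) 0) \<le> B * norm (t - 0)"
      by (rule field_differentiable_bound[where S=UNIV and f'="\<lambda>t. partial j \<eta> (z + t *\<^sub>R axis j 1)"])
        (simp_all add: D' B)
    then show ?thesis by simp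
  qed
  let ?\<Phi> = "\<lambda>t. \<integral>y. v y * \<eta> (x + t *\<^sub>R axis j 1 - y) \<partial>lborel"
  let ?q = "\<lambda>t y. v y * ((\<eta> ((x - y) + t *\<^sub>R axis j 1) - \<eta> (x - y)) / t)"
  have int: "integrable lborel (\<lambda>y. v y * \<eta> (x + t *\<^sub>R axis j 1 - y))" for t
    by (rule integrable_mult_bounded[OF v, where B=B]) (simp_all add: B(1))
  have quot: "(?\<Phi> (0 + t) - ?\<Phi> 0) / t = integral\<^sup>L lborel (?q t)" if "t \<noteq> 0" for t
  proof -
    have "?\<Phi> (0 + t) - ?\<Phi> 0 = (\<integral>y. v y * \<eta> (x + t *\<^sub>R axis j 1 - y) - v y * \<eta> (x + 0 *\<^sub>R axis j 1 - y) \<partial>lborel)"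
      using Bochner_Integration.integral_diff[OF int[of t] int[of 0]] by simp
    also have "\<dots> = (\<integral>y. v y * (\<eta> ((x - y) + t *\<^sub>R axis j 1) - \<eta> (x - y)) \<partial>lborel)"
      by (simp add: algebra_simps)
    finally show ?thesis by simp
  qed
  show ?thesis unfolding DERIV_def tendsto_at_iff_sequentially
  proof (intro allI impI)
    fix X :: "nat \<Rightarrow> real" assume X: "\<forall>i. X i \<in> UNIV - {0}" "X \<longlonglongrightarrow> 0"
    have "(\<lambda>i. integral\<^sup>L lborel (?q (X i))) \<longlonglongrightarrow> (\<integral>y. v y * partial j \<eta> (x - y) \<partial>lborel)"
    proof (rule integral_dominated_convergence[where w="\<lambda>y. B * \<bar>v y\<bar>"])
      show "integrable lborel (\<lambda>y. B * \<bar>v y\<bar>)" using v by simp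
      show "AE y in lborel. (\<lambda>i. ?q (X i) y) \<longlonglongrightarrow> v y * partial j \<eta> (x - y)"
      proof (intro always_eventually allI tendsto_mult tendsto_const)
        fix y
        have "((\<lambda>t. (\<eta> ((x - y) + t *\<^sub>R axis j 1) - \<eta> (x - y)) / t) \<longlongrightarrow> partial j \<eta> (x - y)) (at 0)"
          using D[of "x - y"] by (simp add: DERIV_def)
        then show "(\<lambda>i. (\<eta> ((x - y) + X i *\<^sub>R axis j 1) - \<eta> (x - y)) / X i) \<longlonglongrightarrow> partial j \<eta> (x - y)"
          using X unfolding tendsto_at_iff_sequentially by (auto simp: o_def)
      qed
      show "AE y in lborel. norm (?q (X i) y) \<le> B * \<bar>v y\<bar>" for i
      proof (intro always_eventually allI)
        fix y
        have "\<bar>(\<eta> ((x - y) + X i *\<^sub>R axis j 1) - \<eta> (x - y)) / X i\<bar> \<le> B"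
          using lip[of "x - y" "X i"] X(1) by (auto simp: abs_divide divide_le_eq)
        then show "norm (?q (X i) y) \<le> B * \<bar>v y\<bar>"
          unfolding real_norm_def abs_mult by (subst mult.commute) (rule mult_right_mono, auto)
      qed
    qed measurable
    then show "((\<lambda>h. (?\<Phi> (0 + h) - ?\<Phi> 0) / h) \<circ> X) \<longlonglongrightarrow> (\<integral>y. v y * partial j \<eta> (x - y) \<partial>lborel)"
      using quot X(1) by (simp add: o_def)
  qed
qed

text \<open>Fubini moves the mollifier from \<open>v\<close> onto the indicator of the box.
  Convergence of box integrals is all that is needed later, so no convergence of the mollified
  functions in the mean is established.\<close>

lemma integral_box_convolution:
  fixes v :: "'a::euclidean_space \<Rightarrow> real" and \<eta> :: "nat \<Rightarrow> 'a \<Rightarrow> real"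
  assumes v: "integrable lborel v"
    and cont: "\<And>n. continuous_on UNIV (\<eta> n)" and nonneg: "\<And>n z. 0 \<le> \<eta> n z"
    and supp: "\<And>n z. e n < norm z \<Longrightarrow> \<eta> n z = 0"
    and int\<eta>: "\<And>n. integrable lborel (\<eta> n)" "\<And>n. integral\<^sup>L lborel (\<eta> n) = 1"
    and e: "e \<longlonglongrightarrow> (0::real)"
  shows "integrable lborel (\<lambda>x. indicator (box a b) x * (\<integral>y. v y * \<eta> n (x - y) \<partial>lborel))"
    and "(\<lambda>n. \<integral>x. indicator (box a b) x * (\<integral>y. v y * \<eta> n (x - y) \<partial>lborel) \<partial>lborel)
      \<longlonglongrightarrow> (\<integral>x. indicator (box a b) x * v x \<partial>lborel)"
proof -
  have [measurable]: "v \<in> borel_measurable borel" "\<eta> n \<in> borel_measurable borel" for n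
    using v cont by (auto dest: borel_measurable_integrable intro: borel_measurable_continuous_onI)
  define f where "f n x y = indicator (box a b) x * (v y * \<eta> n (x - y))" for n x y
  have [measurable]: "case_prod (f n) \<in> borel_measurable (lborel \<Otimes>\<^sub>M lborel)" for n
    unfolding f_def by measurable
  have ind1: "integrable lborel (\<lambda>x. indicator (box a b) x * c :: real)" for c
    using integrable_real_indicator[of "box a b" lborel] emeasure_lborel_box_finite[of a b] by simp
  have int_f: "integrable (lborel \<Otimes>\<^sub>M lborel) (case_prod (f n))" for n
  proof (rule lborel_pair.Fubini_integrable)
    obtain C where C: "\<And>z. \<bar>\<eta> n z\<bar> \<le> C" using bounded_if_zero_outside_cball[OF cont supp] by blast
    have i1: "integrable lborel (\<lambda>y. v y * \<eta> n (x - y))" for x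
      by (rule integrable_mult_bounded[OF v, where B=C]) (simp_all add: C)
    have i2: "integrable lborel (f n x)" for x
      unfolding f_def using i1 by simp
    then show "AE x in lborel. integrable lborel (\<lambda>y. case_prod (f n) (x, y))" by simp
    show "integrable lborel (\<lambda>x. \<integral>y. norm (case_prod (f n) (x, y)) \<partial>lborel)"
    proof (rule Bochner_Integration.integrable_bound)
      show "integrable lborel (\<lambda>x. indicator (box a b) x * (\<integral>y. C * \<bar>v y\<bar> \<partial>lborel))" by (rule ind1)
      show "AE x in lborel. norm (\<integral>y. norm (case_prod (f n) (x, y)) \<partial>lborel)
         \<le> norm (indicator (box a b) x * (\<integral>y. C * \<bar>v y\<bar> \<partial>lborel))"
      proof (intro always_eventually allI)
        fix x
        have "(\<integral>y. norm (f n x y) \<partial>lborel) \<le> (\<integral>y. indicator (box a b) x * (C * \<bar>v y\<bar>) \<partial>lborel)"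
        proof (rule integral_mono)
          show "integrable lborel (\<lambda>y. norm (f n x y))" using i2 by (intro integrable_norm)
          show "integrable lborel (\<lambda>y. indicator (box a b) x * (C * \<bar>v y\<bar>))" using v by simp
          fix y
          have "\<bar>v y\<bar> * \<bar>\<eta> n (x - y)\<bar> \<le> \<bar>v y\<bar> * C" by (intro mult_left_mono C) simp
          then show "norm (f n x y) \<le> indicator (box a b) x * (C * \<bar>v y\<bar>)"
            by (auto simp: f_def indicator_def abs_mult mult.commute)
        qed
        moreover have "0 \<le> (\<integral>y. norm (f n x y) \<partial>lborel)"
          by (intro Bochner_Integration.integral_nonneg) simp
        ultimately show "norm (\<integral>y. norm (case_prod (f n) (x, y)) \<partial>lborel)
         \<le> norm (indicator (box a b) x * (\<integral>y. C * \<bar>v y\<bar> \<partial>lborel))"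
          by (simp add: abs_of_nonneg)
      qed
    qed measurable
  qed measurable
  have fst: "(\<integral>y. f n x y \<partial>lborel) = indicator (box a b) x * (\<integral>y. v y * \<eta> n (x - y) \<partial>lborel)" for n x
    by (simp add: f_def)
  show "integrable lborel (\<lambda>x. indicator (box a b) x * (\<integral>y. v y * \<eta> n (x - y) \<partial>lborel))"
    using lborel_pair.integrable_fst[OF int_f[of n]] unfolding fst .
  \<comment> \<open>\<open>\<Psi> n\<close> is the mollified indicator, with values between 0 and
    1.\<close>
  define \<Psi> where "\<Psi> n y = (\<integral>x. indicator (box a b) x * \<eta> n (x - y) \<partial>lborel)" for n y
  have snd: "(\<integral>x. f n x y \<partial>lborel) = v y * \<Psi> n y" for n y
    unfolding f_def \<Psi>_def by (subst Bochner_Integration.integral_mult_right_zero[symmetric]) (simp add: mult_ac)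
  have int_\<Psi>: "integrable lborel (\<lambda>x. indicator (box a b) x * \<eta> n (x - y))" for n y
    using integrable_mult_indicator[OF _ integrable_lborel_shift[OF int\<eta>(1)], of "box a b"] by simp
  have \<Psi>_nonneg: "0 \<le> \<Psi> n y" for n y
    unfolding \<Psi>_def using nonneg by (intro Bochner_Integration.integral_nonneg) simp
  have \<Psi>_le: "\<Psi> n y \<le> 1" for n y
  proof -
    have "\<Psi> n y \<le> (\<integral>x. \<eta> n (x - y) \<partial>lborel)"
      unfolding \<Psi>_def by (intro integral_mono int_\<Psi> integrable_lborel_shift int\<eta>(1)) (simp add: indicator_def nonneg)
    then show ?thesis by (simp add: integral_lborel_shift int\<eta>)
  qed
  \<comment> \<open>Off the boundary a small ball around \<open>y\<close> lies in the box or misses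
    its closure, so \<open>\<Psi> n y\<close> is eventually constant. The boundary is null and is
    discarded below.\<close>
  have \<Psi>_lim: "(\<lambda>n. \<Psi> n y) \<longlonglongrightarrow> indicator (box a b) y" if y: "y \<notin> cbox a b - box a b" for y
  proof (cases "y \<in> box a b")
    case True
    then obtain d where d: "d > 0" "ball y d \<subseteq> box a b" using open_box open_contains_ball by metis
    have "eventually (\<lambda>n. e n < d) sequentially" using order_tendstoD(2)[OF e d(1)] .
    then have "eventually (\<lambda>n. \<Psi> n y = 1) sequentially"
    proof eventually_elim
      case (elim n)
      have eq: "indicator (box a b) x * \<eta> n (x - y) = \<eta> n (x - y)" for x
      proof (cases "x \<in> ball y d")
        case True then show ?thesis using d by auto
      next
        case False
        then have "e n < norm (x - y)" using elim by (simp add: dist_norm norm_minus_commute)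
        then show ?thesis using supp by simp
      qed
      show ?case unfolding \<Psi>_def eq by (simp add: integral_lborel_shift int\<eta>)
    qed
    then show ?thesis using True by (simp add: tendsto_eventually)
  next
    case False
    then have "y \<in> - cbox a b" using y by blast
    then obtain d where d: "d > 0" "ball y d \<subseteq> - cbox a b" using closed_cbox open_contains_ball open_Compl by metis
    have "eventually (\<lambda>n. e n < d) sequentially" using order_tendstoD(2)[OF e d(1)] .
    then have "eventually (\<lambda>n. \<Psi> n y = 0) sequentially"
    proof eventually_elim
      case (elim n)
      have eq: "indicator (box a b) x * \<eta> n (x - y) = 0" for x
      proof (cases "x \<in> ball y d")
        case True
        then have "x \<notin> box a b" using d box_subset_cbox by blast
        then show ?thesis by simp
      next
        case False
        then have "e n < norm (x - y)" using elim by (simp add: dist_norm norm_minus_commute)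
        then show ?thesis using supp by simp
      qed
      show ?case unfolding \<Psi>_def eq by simp
    qed
    then show ?thesis using False by (simp add: tendsto_eventually)
  qed
  have [measurable]: "\<Psi> n \<in> borel_measurable borel" for n
  proof -
    have "(\<lambda>y. \<integral>x. indicator (box a b) x * \<eta> n (x - y) \<partial>lborel) \<in> borel_measurable lborel"
      by (rule lborel.borel_measurable_lebesgue_integral) measurable
    then show ?thesis by (simp add: \<Psi>_def[abs_def])
  qed
  have "(\<lambda>n. \<integral>y. v y * \<Psi> n y \<partial>lborel) \<longlonglongrightarrow> (\<integral>y. v y * indicator (box a b) y \<partial>lborel)"
  proof (rule integral_dominated_convergence[where w="\<lambda>y. \<bar>v y\<bar>"])
    show "integrable lborel (\<lambda>y. \<bar>v y\<bar>)" using v by simp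
    have "AE y in lborel. y \<notin> cbox a b - box a b"
      using null_sets_cbox_Diff_box by (rule AE_not_in)
    then show "AE y in lborel. (\<lambda>n. v y * \<Psi> n y) \<longlonglongrightarrow> v y * indicator (box a b) y"
      by eventually_elim (intro tendsto_mult tendsto_const \<Psi>_lim)
    show "AE y in lborel. norm (v y * \<Psi> n y) \<le> \<bar>v y\<bar>" for n
      using \<Psi>_le[of n] \<Psi>_nonneg[of n] by (auto simp: abs_mult mult_left_le)
  qed measurable
  moreover have "(\<integral>y. v y * \<Psi> n y \<partial>lborel) = (\<integral>x. indicator (box a b) x * (\<integral>y. v y * \<eta> n (x - y) \<partial>lborel) \<partial>lborel)" for n
    using lborel_pair.Fubini_integral[OF int_f[of n]] unfolding fst snd .
  ultimately show "(\<lambda>n. \<integral>x. indicator (box a b) x * (\<integral>y. v y * \<eta> n (x - y) \<partial>lborel) \<partial>lborel)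
      \<longlonglongrightarrow> (\<integral>x. indicator (box a b) x * v x \<partial>lborel)"
    by (simp add: mult.commute)
qed

section \<open>Functions with continuous weak gradient\<close>

text \<open>Each convolution is an average of \<open>G\<close> over \<open>cball x (e n)\<close>,
  and \<open>G\<close> is uniformly continuous on the compact \<open>K\<close>. The margin
  \<open>\<rho>\<close> keeps these balls inside \<open>K\<close> for all \<open>x\<close> in
  \<open>Q\<close> simultaneously.\<close>

lemma convolution_uniform_limit:
  fixes G :: "'a::euclidean_space \<Rightarrow> real" and \<eta> :: "nat \<Rightarrow> 'a \<Rightarrow> real"
  assumes K: "compact K" "continuous_on K G" and \<rho>: "\<rho> > 0" "\<And>x. x \<in> Q \<Longrightarrow> cball x \<rho> \<subseteq> K"
    and cont: "\<And>n. continuous_on UNIV (\<eta> n)" and nonneg: "\<And>n z. 0 \<le> \<eta> n z"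
    and supp: "\<And>n z. e n < norm z \<Longrightarrow> \<eta> n z = 0"
    and int\<eta>: "\<And>n. integrable lborel (\<eta> n)" "\<And>n. integral\<^sup>L lborel (\<eta> n) = 1"
    and e: "e \<longlonglongrightarrow> (0::real)" and \<epsilon>: "\<epsilon> > 0"
  shows "eventually (\<lambda>n. \<forall>x\<in>Q. \<bar>(\<integral>y. G y * \<eta> n (x - y) \<partial>lborel) - G x\<bar> \<le> \<epsilon>) sequentially"
proof -
  have "uniformly_continuous_on K G" using K by (intro compact_uniformly_continuous)
  then obtain \<delta> where \<delta>: "\<delta> > 0" "\<And>x y. x \<in> K \<Longrightarrow> y \<in> K \<Longrightarrow> dist y x < \<delta> \<Longrightarrow> dist (G y) (G x) < \<epsilon>"
    using \<epsilon> unfolding uniformly_continuous_on_def by metis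
  have "eventually (\<lambda>n. e n < min \<delta> \<rho>) sequentially"
    using order_tendstoD(2)[OF e, of "min \<delta> \<rho>"] \<delta> \<rho> by simp
  then show ?thesis
  proof eventually_elim
    case (elim n)
    show ?case
    proof
      fix x assume x: "x \<in> Q"
      have zero: "\<eta> n (x - y) = 0" if "y \<notin> cball x (e n)" for y
        using that by (intro supp) (simp add: dist_norm)
      have sub: "cball x (e n) \<subseteq> K" using \<rho>(2)[OF x] elim by force
      have close: "\<bar>G y - G x\<bar> \<le> \<epsilon>" if "y \<in> cball x (e n)" for y
      proof -
        have "dist y x < \<delta>" using that elim by (simp add: dist_commute)
        moreover have "x \<in> K" using \<rho>(2)[OF x] \<rho>(1) by force
        ultimately show ?thesis using \<delta>(2)[of x y] sub that by (auto simp: dist_real_def)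
      qed
      have c: "continuous_on (cball x (e n)) (\<lambda>y. \<eta> n (x - y))"
        by (rule continuous_on_compose2[OF cont]) (auto intro: continuous_intros)
      \<comment> \<open>Nothing is known of \<open>G\<close> outside \<open>K\<close>, but the
        mollifier vanishes there, so the indicator can be inserted and removed freely.\<close>
      have "integrable lborel (\<lambda>y. indicator (cball x (e n)) y *\<^sub>R (G y * \<eta> n (x - y)))"
        by (intro borel_integrable_compact compact_cball continuous_on_mult c continuous_on_subset[OF K(2) sub])
      moreover have "(\<lambda>y. indicator (cball x (e n)) y *\<^sub>R (G y * \<eta> n (x - y))) = (\<lambda>y. G y * \<eta> n (x - y))"
        using zero by (auto simp: fun_eq_iff indicator_def)
      ultimately have i1: "integrable lborel (\<lambda>y. G y * \<eta> n (x - y))" by simp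
      have i0: "integrable lborel (\<lambda>y. \<eta> n (x - y))" by (rule integrable_lborel_reflect[OF int\<eta>(1)])
      have i2: "integrable lborel (\<lambda>y. G x * \<eta> n (x - y))" using i0 by simp
      have "(\<integral>y. G y * \<eta> n (x - y) \<partial>lborel) - G x
        = (\<integral>y. G y * \<eta> n (x - y) - G x * \<eta> n (x - y) \<partial>lborel)"
        using Bochner_Integration.integral_diff[OF i1 i2] by (simp add: integral_lborel_reflect[OF int\<eta>(1)] int\<eta>(2))
      moreover have "\<bar>\<integral>y. G y * \<eta> n (x - y) - G x * \<eta> n (x - y) \<partial>lborel\<bar> \<le> (\<integral>y. \<epsilon> * \<eta> n (x - y) \<partial>lborel)"
      proof (rule integral_abs_bound[THEN order_trans], rule integral_mono)
        show "integrable lborel (\<lambda>y. \<bar>G y * \<eta> n (x - y) - G x * \<eta> n (x - y)\<bar>)" using i1 i2 by simp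
        show "integrable lborel (\<lambda>y. \<epsilon> * \<eta> n (x - y))" using i0 by simp
        fix y
        show "\<bar>G y * \<eta> n (x - y) - G x * \<eta> n (x - y)\<bar> \<le> \<epsilon> * \<eta> n (x - y)"
        proof (cases "y \<in> cball x (e n)")
          case True
          have "\<bar>G y - G x\<bar> * \<eta> n (x - y) \<le> \<epsilon> * \<eta> n (x - y)"
            by (intro mult_right_mono close True nonneg)
          moreover have "\<bar>G y * \<eta> n (x - y) - G x * \<eta> n (x - y)\<bar> = \<bar>G y - G x\<bar> * \<eta> n (x - y)"
            using nonneg[of n "x - y"] by (simp add: left_diff_distrib[symmetric] abs_mult)
          ultimately show ?thesis by simp
        qed (simp add: zero)
      qed
      ultimately show "\<bar>(\<integral>y. G y * \<eta> n (x - y) \<partial>lborel) - G x\<bar> \<le> \<epsilon>"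
        by (simp add: integral_lborel_reflect[OF int\<eta>(1)] int\<eta>(2))
    qed
  qed
qed

lemma continuous_on_if_l1_lipschitz:
  fixes h :: "real^'n::finite \<Rightarrow> real"
  assumes "\<And>x y. x \<in> Q \<Longrightarrow> y \<in> Q \<Longrightarrow> \<bar>h y - h x\<bar> \<le> C * (\<Sum>i\<in>UNIV. \<bar>y $ i - x $ i\<bar>)"
  shows "continuous_on Q h"
  unfolding continuous_on_def
proof
  fix x assume x: "x \<in> Q"
  have "((\<lambda>y. C * (\<Sum>i\<in>UNIV. \<bar>y $ i - x $ i\<bar>)) \<longlongrightarrow> C * (\<Sum>i\<in>UNIV. \<bar>x $ i - x $ i\<bar>)) (at x within Q)"
    by (intro tendsto_intros)
  then have lim: "((\<lambda>y. C * (\<Sum>i\<in>UNIV. \<bar>y $ i - x $ i\<bar>)) \<longlongrightarrow> 0) (at x within Q)" by simp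
  have "((\<lambda>y. h y - h x) \<longlongrightarrow> 0) (at x within Q)"
    by (rule Lim_null_comparison[OF _ lim]) (use assms x in \<open>auto simp: eventually_at_filter\<close>)
  then show "(h \<longlongrightarrow> h x) (at x within Q)" by (rule LIM_zero_cancel)
qed

text \<open>The values of \<open>F n\<close> are not assumed to converge at any point, hence the
  limit is taken of increments from \<open>x1\<close>. The Lipschitz bound for
  \<open>F n - F m\<close> gives an error proportional to the distance of the points, and this
  relative rate is what lets the derivative pass to the limit.\<close>

lemma limit_of_uniformly_convergent_partials:
  fixes F :: "nat \<Rightarrow> real^'n::finite \<Rightarrow> real"
  assumes x1: "x1 \<in> box a b"
    and F': "\<And>\<epsilon>. \<epsilon> > 0 \<Longrightarrow> eventually (\<lambda>n. \<forall>j. \<forall>x\<in>box a b. \<bar>F' n j x - G j x\<bar> \<le> \<epsilon>) sequentially"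
    and dF: "eventually (\<lambda>n. \<forall>j. \<forall>x\<in>box a b. ((\<lambda>t. F n (x + t *\<^sub>R axis j 1)) has_real_derivative F' n j x) (at 0)) sequentially"
  obtains h where "h x1 = 0"
    and "\<And>\<epsilon>. \<epsilon> > 0 \<Longrightarrow> eventually (\<lambda>n. \<forall>x\<in>box a b. \<forall>y\<in>box a b.
           \<bar>(F n y - F n x) - (h y - h x)\<bar> \<le> \<epsilon> * (\<Sum>i\<in>UNIV. \<bar>y $ i - x $ i\<bar>)) sequentially"
    and "\<And>j x. x \<in> box a b \<Longrightarrow> ((\<lambda>t. h (x + t *\<^sub>R axis j 1)) has_real_derivative G j x) (at 0)"
proof -
  let ?Q = "box a b" and ?s = "\<lambda>x y :: real^'n. \<Sum>i\<in>UNIV. \<bar>y $ i - x $ i\<bar>"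
  have good: "\<exists>N. \<forall>n\<ge>N. \<forall>j. \<forall>x\<in>?Q. \<bar>F' n j x - G j x\<bar> \<le> \<epsilon> \<and>
      ((\<lambda>t. F n (x + t *\<^sub>R axis j 1)) has_real_derivative F' n j x) (at 0)" if "\<epsilon> > 0" for \<epsilon>
    using eventually_conj[OF F'[OF that] dF] unfolding eventually_sequentially by blast
  have cauchy: "\<exists>N. \<forall>n\<ge>N. \<forall>m\<ge>N. \<forall>x\<in>?Q. \<forall>y\<in>?Q. \<bar>(F n y - F n x) - (F m y - F m x)\<bar> \<le> \<epsilon> * ?s x y" if \<epsilon>: "\<epsilon> > 0" for \<epsilon>
  proof -
    have "\<epsilon> / 2 > 0" using \<epsilon> by simp
    from good[OF this] obtain N where N: "\<And>n j x. n \<ge> N \<Longrightarrow> x \<in> ?Q \<Longrightarrow> \<bar>F' n j x - G j x\<bar> \<le> \<epsilon> / 2"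
        "\<And>n j x. n \<ge> N \<Longrightarrow> x \<in> ?Q \<Longrightarrow> ((\<lambda>t. F n (x + t *\<^sub>R axis j 1)) has_real_derivative F' n j x) (at 0)"
      by blast
    have "\<bar>(F n y - F n x) - (F m y - F m x)\<bar> \<le> \<epsilon> * ?s x y"
      if nm: "n \<ge> N" "m \<ge> N" and xy: "x \<in> ?Q" "y \<in> ?Q" for n m x y
    proof -
      have "\<bar>(F n y - F m y) - (F n x - F m x)\<bar> \<le> \<epsilon> * ?s x y"
      proof (rule partials_bounded_imp_lipschitz_on_box[OF xy, where D="\<lambda>j x. F' n j x - F' m j x"])
        fix z j assume z: "z \<in> ?Q"
        show "((\<lambda>t. F n (z + t *\<^sub>R axis j 1) - F m (z + t *\<^sub>R axis j 1)) has_real_derivative F' n j z - F' m j z) (at 0)"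
          by (intro DERIV_diff N z nm)
        show "\<bar>F' n j z - F' m j z\<bar> \<le> \<epsilon>"
          using N(1)[OF nm(1) z, of j] N(1)[OF nm(2) z, of j] by linarith
      qed
      then show ?thesis by (simp add: algebra_simps)
    qed
    then show ?thesis by blast
  qed
  have conv: "convergent (\<lambda>n. F n x - F n x1)" if x: "x \<in> ?Q" for x
    unfolding Cauchy_convergent_iff[symmetric]
  proof (rule CauchyI)
    fix r :: real assume r: "r > 0"
    have s: "?s x1 x \<ge> 0" by (intro sum_nonneg) simp
    define S where "S = ?s x1 x + 1"
    have S: "S > 0" unfolding S_def using s by linarith
    define \<epsilon> where "\<epsilon> = r / (2 * S)"
    have "\<epsilon> > 0" using r S by (simp add: \<epsilon>_def)
    from cauchy[OF this] obtain N where N: "\<And>n m. n \<ge> N \<Longrightarrow> m \<ge> N \<Longrightarrow> \<bar>(F n x - F n x1) - (F m x - F m x1)\<bar> \<le> \<epsilon> * ?s x1 x"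
      using x x1 by blast
    have "\<epsilon> * ?s x1 x \<le> \<epsilon> * S" using \<open>\<epsilon> > 0\<close> unfolding S_def by (intro mult_left_mono) auto
    also have "\<dots> = r / 2" using S by (simp add: \<epsilon>_def)
    also have "\<dots> < r" using r by simp
    finally show "\<exists>M. \<forall>m\<ge>M. \<forall>n\<ge>M. norm ((F m x - F m x1) - (F n x - F n x1)) < r"
      using N unfolding real_norm_def by (meson order_le_less_trans)
  qed
  define h where "h x = lim (\<lambda>n. F n x - F n x1)" for x
  have h: "(\<lambda>n. F n x - F n x1) \<longlonglongrightarrow> h x" if "x \<in> ?Q" for x
    using conv[OF that] unfolding h_def by (simp add: convergent_LIMSEQ_iff)
  have h1: "h x1 = 0" by (simp add: h_def)
  have rate: "\<exists>N. \<forall>n\<ge>N. \<forall>x\<in>?Q. \<forall>y\<in>?Q. \<bar>(F n y - F n x) - (h y - h x)\<bar> \<le> \<epsilon> * ?s x y" if \<epsilon>: "\<epsilon> > 0" for \<epsilon>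
  proof -
    obtain N where N: "\<And>n m x y. n \<ge> N \<Longrightarrow> m \<ge> N \<Longrightarrow> x \<in> ?Q \<Longrightarrow> y \<in> ?Q \<Longrightarrow> \<bar>(F n y - F n x) - (F m y - F m x)\<bar> \<le> \<epsilon> * ?s x y"
      using cauchy[OF \<epsilon>] by blast
    \<comment> \<open>The Cauchy estimate with \<open>m\<close> sent to infinity.\<close>
    have "\<bar>(F n y - F n x) - (h y - h x)\<bar> \<le> \<epsilon> * ?s x y" if n: "n \<ge> N" and xy: "x \<in> ?Q" "y \<in> ?Q" for n x y
    proof (rule tendsto_upperbound)
      have "(\<lambda>m. (F m y - F m x1) - (F m x - F m x1)) \<longlonglongrightarrow> h y - h x"
        by (intro tendsto_diff h xy)
      then have "(\<lambda>m. F m y - F m x) \<longlonglongrightarrow> h y - h x" by simp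
      then show "(\<lambda>m. \<bar>(F n y - F n x) - (F m y - F m x)\<bar>) \<longlonglongrightarrow> \<bar>(F n y - F n x) - (h y - h x)\<bar>"
        using tendsto_rabs[OF tendsto_diff[OF tendsto_const]] by blast
      show "eventually (\<lambda>m. \<bar>(F n y - F n x) - (F m y - F m x)\<bar> \<le> \<epsilon> * ?s x y) sequentially"
        using N n xy unfolding eventually_sequentially by blast
    qed simp
    then show ?thesis by blast
  qed
  have deriv: "((\<lambda>t. h (x + t *\<^sub>R axis j 1)) has_real_derivative G j x) (at 0)" if x: "x \<in> ?Q" for j x
    unfolding has_field_derivative_def has_derivative_at_alt
  proof (intro conjI allI impI)
    show "bounded_linear ((*) (G j x))" by (rule bounded_linear_mult_right)
    fix \<epsilon> :: real assume "\<epsilon> > 0"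
    \<comment> \<open>The thirds pay for replacing the increment of \<open>h\<close> by that of
      \<open>F n\<close>, for the differentiability of \<open>F n\<close>, and for replacing
      \<open>F' n j x\<close> by \<open>G j x\<close>. The index \<open>n\<close> is fixed before
      the radius is chosen.\<close>
    then have \<epsilon>: "\<epsilon> / 3 > 0" by simp
    obtain N1 where N1: "\<And>n. n \<ge> N1 \<Longrightarrow> \<bar>F' n j x - G j x\<bar> \<le> \<epsilon> / 3"
       "\<And>n. n \<ge> N1 \<Longrightarrow> ((\<lambda>t. F n (x + t *\<^sub>R axis j 1)) has_real_derivative F' n j x) (at 0)"
      using good[OF \<epsilon>] x by blast
    obtain N2 where N2: "\<And>n x y. n \<ge> N2 \<Longrightarrow> x \<in> ?Q \<Longrightarrow> y \<in> ?Q \<Longrightarrow> \<bar>(F n y - F n x) - (h y - h x)\<bar> \<le> \<epsilon> / 3 * ?s x y"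
      using rate[OF \<epsilon>] by blast
    define n where "n = max N1 N2"
    have n: "n \<ge> N1" "n \<ge> N2" by (auto simp: n_def)
    obtain d1 where d1: "d1 > 0" "\<And>t. norm (t - 0) < d1 \<Longrightarrow> norm (F n (x + t *\<^sub>R axis j 1) - F n (x + 0 *\<^sub>R axis j 1) - F' n j x * (t - 0)) \<le> \<epsilon> / 3 * norm (t - 0)"
      using N1(2)[OF n(1)] \<epsilon> unfolding has_field_derivative_def has_derivative_at_alt by metis
    have "eventually (\<lambda>t. x + t *\<^sub>R axis j 1 \<in> ?Q) (nhds 0)"
      using eventually_line_in_open[OF open_box x] .
    then obtain d2 where d2: "d2 > 0" "\<And>t. dist t 0 < d2 \<Longrightarrow> x + t *\<^sub>R axis j 1 \<in> ?Q"
      unfolding eventually_nhds_metric by blast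
    show "\<exists>d>0. \<forall>t. norm (t - 0) < d \<longrightarrow> norm (h (x + t *\<^sub>R axis j 1) - h (x + 0 *\<^sub>R axis j 1) - G j x * (t - 0)) \<le> \<epsilon> * norm (t - 0)"
    proof (intro exI[of _ "min d1 d2"] conjI allI impI)
      show "0 < min d1 d2" using d1 d2 by simp
      fix t :: real assume t: "norm (t - 0) < min d1 d2"
      let ?y = "x + t *\<^sub>R axis j 1"
      have "?y \<in> ?Q" using d2(2)[of t] t by simp
      have "?s x ?y = (\<Sum>i\<in>UNIV. if i = j then \<bar>t\<bar> else 0)"
        by (intro sum.cong) (auto simp: axis_def)
      then have s: "?s x ?y = \<bar>t\<bar>" by simp
      have a: "\<bar>(F n ?y - F n x) - (h ?y - h x)\<bar> \<le> \<epsilon> / 3 * \<bar>t\<bar>"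
        using N2[OF n(2) x \<open>?y \<in> ?Q\<close>] unfolding s .
      have b: "\<bar>F n ?y - F n x - F' n j x * t\<bar> \<le> \<epsilon> / 3 * \<bar>t\<bar>" using d1(2)[of t] t by simp
      have "\<bar>F' n j x - G j x\<bar> * \<bar>t\<bar> \<le> \<epsilon> / 3 * \<bar>t\<bar>" by (intro mult_right_mono N1(1) n) simp
      then have c: "\<bar>F' n j x * t - G j x * t\<bar> \<le> \<epsilon> / 3 * \<bar>t\<bar>"
        by (simp add: left_diff_distrib[symmetric] abs_mult)
      have "\<bar>h ?y - h x - G j x * t\<bar> \<le> \<epsilon> / 3 * \<bar>t\<bar> + \<epsilon> / 3 * \<bar>t\<bar> + \<epsilon> / 3 * \<bar>t\<bar>"
        using a b c by linarith
      then show "norm (h ?y - h (x + 0 *\<^sub>R axis j 1) - G j x * (t - 0)) \<le> \<epsilon> * norm (t - 0)"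
        by simp
    qed
  qed
  show thesis
    by (rule that[OF h1 _ deriv]) (use rate in \<open>auto simp: eventually_sequentially\<close>)
qed

text \<open>By \<open>weak\<close>, the partial derivatives of the mollified \<open>v\<close> are
  the mollified \<open>G j\<close>, which converge uniformly. This gives a limit \<open>h0\<close>
  up to a constant; integrals over boxes determine the constant and show that \<open>v\<close>
  agrees with the limit almost everywhere.\<close>

lemma weak_gradient_local:
  fixes v :: "real^'n::finite \<Rightarrow> real" and \<eta> :: "nat \<Rightarrow> real^'n \<Rightarrow> real" and G :: "'n \<Rightarrow> real^'n \<Rightarrow> real"
  assumes v: "integrable lborel v" and K: "compact K" "\<And>j. continuous_on K (G j)"
    and x1: "x1 \<in> box a b" and \<rho>: "\<rho> > 0" "\<And>x. x \<in> box a b \<Longrightarrow> cball x \<rho> \<subseteq> K"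
    and smooth: "\<And>n. smooth_on UNIV (\<eta> n)" and nonneg: "\<And>n z. 0 \<le> \<eta> n z"
    and supp: "\<And>n z. e n < norm z \<Longrightarrow> \<eta> n z = 0"
    and int\<eta>: "\<And>n. integrable lborel (\<eta> n)" "\<And>n. integral\<^sup>L lborel (\<eta> n) = 1"
    and e: "e \<longlonglongrightarrow> (0::real)"
    and weak: "\<And>n x j. e n < \<rho> \<Longrightarrow> x \<in> box a b \<Longrightarrow>
       (\<integral>y. v y * partial j (\<eta> n) (x - y) \<partial>lborel) = (\<integral>y. G j y * \<eta> n (x - y) \<partial>lborel)"
  shows "\<exists>h. (\<forall>x\<in>box a b. (\<lambda>n. \<integral>y. v y * \<eta> n (x - y) \<partial>lborel) \<longlonglongrightarrow> h x)
    \<and> continuous_on (box a b) h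
    \<and> (\<forall>j. \<forall>x\<in>box a b. ((\<lambda>t. h (x + t *\<^sub>R axis j 1)) has_real_derivative G j x) (at 0))
    \<and> (AE x in lborel. x \<in> box a b \<longrightarrow> v x = h x)"
proof -
  let ?Q = "box a b" and ?s = "\<lambda>x y :: real^'n. \<Sum>i\<in>UNIV. \<bar>y $ i - x $ i\<bar>"
  define F where "F n x = (\<integral>y. v y * \<eta> n (x - y) \<partial>lborel)" for n x
  have ck: "ck m UNIV (\<eta> n)" for m n using smooth by (simp add: smooth_on_iff_ck)
  have cont: "continuous_on UNIV (\<eta> n)" for n using ck[of 0] by simp
  have [measurable]: "v \<in> borel_measurable borel" "\<eta> n \<in> borel_measurable borel" for n
    using v cont by (auto dest: borel_measurable_integrable intro: borel_measurable_continuous_onI)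
  have F': "eventually (\<lambda>n. \<forall>j. \<forall>x\<in>?Q. \<bar>(\<integral>y. G j y * \<eta> n (x - y) \<partial>lborel) - G j x\<bar> \<le> \<epsilon>) sequentially"
    if "\<epsilon> > 0" for \<epsilon>
    by (intro eventually_all_finite convolution_uniform_limit[OF K(1) K(2) \<rho> cont nonneg supp int\<eta> e that])
  have "eventually (\<lambda>n. e n < \<rho>) sequentially" using order_tendstoD(2)[OF e \<rho>(1)] .
  then have dF: "eventually (\<lambda>n. \<forall>j. \<forall>x\<in>?Q. ((\<lambda>t. F n (x + t *\<^sub>R axis j 1)) has_real_derivative
     (\<integral>y. G j y * \<eta> n (x - y) \<partial>lborel)) (at 0)) sequentially"
  proof eventually_elim
    case (elim n)
    show ?case
    proof (intro allI ballI)
      fix j x assume x: "x \<in> ?Q"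
      obtain B1 where B1: "\<And>z. \<bar>\<eta> n z\<bar> \<le> B1" using bounded_if_zero_outside_cball[OF cont supp] by blast
      have "continuous_on UNIV (partial j (\<eta> n))" using ck[of "Suc 0" n] by simp
      moreover have "partial j (\<eta> n) z = 0" if "e n < norm z" for z
        using supp that by (rule partial_zero_outside_cball)
      ultimately obtain B2 where B2: "\<And>z. \<bar>partial j (\<eta> n) z\<bar> \<le> B2"
        using bounded_if_zero_outside_cball[of "partial j (\<eta> n)" "e n"] by blast
      have "\<And>z. \<bar>\<eta> n z\<bar> \<le> max B1 B2" "\<And>z. \<bar>partial j (\<eta> n) z\<bar> \<le> max B1 B2"
        using B1 B2 by (simp_all add: le_max_iff_disj)
      from DERIV_convolution[OF v ck this, of x]
      show "((\<lambda>t. F n (x + t *\<^sub>R axis j 1)) has_real_derivative (\<integral>y. G j y * \<eta> n (x - y) \<partial>lborel)) (at 0)"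
        unfolding F_def weak[OF elim x] .
    qed
  qed
  obtain h0 where h0: "h0 x1 = 0"
    "\<And>\<epsilon>. \<epsilon> > 0 \<Longrightarrow> eventually (\<lambda>n. \<forall>x\<in>?Q. \<forall>y\<in>?Q. \<bar>(F n y - F n x) - (h0 y - h0 x)\<bar> \<le> \<epsilon> * ?s x y) sequentially"
    "\<And>j x. x \<in> ?Q \<Longrightarrow> ((\<lambda>t. h0 (x + t *\<^sub>R axis j 1)) has_real_derivative G j x) (at 0)"
    using limit_of_uniformly_convergent_partials[OF x1 F' dF] by blast
  have "\<exists>C. \<forall>x\<in>K. \<bar>G j x\<bar> \<le> C" for j
  proof -
    have "bounded (G j ` K)" using K by (intro compact_imp_bounded compact_continuous_image)
    then show ?thesis by (auto simp: bounded_iff)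
  qed
  then obtain Cj where Cj: "\<And>j x. x \<in> K \<Longrightarrow> \<bar>G j x\<bar> \<le> Cj j" by metis
  have QK: "x \<in> K" if "x \<in> ?Q" for x using \<rho>(1) \<rho>(2)[OF that] by force
  define C where "C = (\<Sum>j\<in>UNIV. \<bar>Cj j\<bar>)"
  have C: "\<bar>G j x\<bar> \<le> C" if "x \<in> ?Q" for j x
  proof -
    have "\<bar>G j x\<bar> \<le> \<bar>Cj j\<bar>" using Cj[OF QK[OF that], of j] by linarith
    also have "\<dots> \<le> C" unfolding C_def by (intro member_le_sum) auto
    finally show ?thesis .
  qed
  have C0: "C \<ge> 0" unfolding C_def by (intro sum_nonneg) simp
  have lip: "\<bar>h0 y - h0 x\<bar> \<le> C * ?s x y" if "x \<in> ?Q" "y \<in> ?Q" for x y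
    by (rule partials_bounded_imp_lipschitz_on_box[OF that h0(3) C])
  have cont_h0: "continuous_on ?Q h0" using lip by (rule continuous_on_if_l1_lipschitz)
  define L where "L = (\<Sum>i\<in>UNIV. b $ i - a $ i)"
  have s_le: "?s x y \<le> L" if "x \<in> ?Q" "y \<in> ?Q" for x y
    unfolding L_def
  proof (rule sum_mono)
    fix i
    have "a $ i < x $ i" "x $ i < b $ i" "a $ i < y $ i" "y $ i < b $ i" using that by (auto simp: mem_box_cart)
    then show "\<bar>y $ i - x $ i\<bar> \<le> b $ i - a $ i" by linarith
  qed
  have L0: "L \<ge> 0" using s_le[OF x1 x1] by simp
  define m where "m B = measure lborel (B :: (real^'n) set)" for B
  have int_v: "integrable lborel (\<lambda>x. indicator (box c d) x * v x)" for c d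
    using integrable_mult_indicator[of "box c d" lborel v] v by simp
  have int_1: "integrable lborel (\<lambda>x. indicator (box c d) x * r)" "(\<integral>x. indicator (box c d) x * r \<partial>lborel) = m (box c d) * r" for c d :: "real^'n" and r :: real
    using integrable_real_indicator[of "box c d" lborel] emeasure_lborel_box_finite[of c d] by (simp_all add: m_def)
  have int_Q: "integrable lborel (\<lambda>x. indicator ?Q x * h0 x)"
  proof (rule Bochner_Integration.integrable_bound)
    show "integrable lborel (\<lambda>x. indicator ?Q x * (C * L))" by (rule int_1)
    show "(\<lambda>x. indicator ?Q x * h0 x) \<in> borel_measurable lborel"
      using borel_measurable_continuous_on_indicator[OF _ cont_h0] by simp
    have "\<bar>h0 x\<bar> \<le> C * L" if "x \<in> ?Q" for x
    proof -
      have "\<bar>h0 x\<bar> \<le> C * ?s x1 x" using lip[OF x1 that] h0(1) by simp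
      also have "\<dots> \<le> C * L" by (intro mult_left_mono s_le x1 that C0)
      finally show ?thesis .
    qed
    then show "AE x in lborel. norm (indicator ?Q x * h0 x) \<le> norm (indicator ?Q x * (C * L))"
      using C0 L0 by (intro always_eventually allI) (simp add: indicator_def abs_mult)
  qed
  have int_h0: "integrable lborel (\<lambda>x. indicator (box c d) x * h0 x)" if "box c d \<subseteq> ?Q" for c d
  proof -
    have "integrable lborel (\<lambda>x. indicator (box c d) x * (indicator ?Q x * h0 x))"
      using integrable_mult_indicator[of "box c d" lborel "\<lambda>x. indicator ?Q x * h0 x"] int_Q by simp
    moreover have "indicator (box c d) x * (indicator ?Q x * h0 x) = indicator (box c d) x * h0 x" for x
      using that by (auto simp: indicator_def)
    ultimately show ?thesis by simp
  qed
  have box_lim: "(\<lambda>n. m (box c d) * F n x1) \<longlonglongrightarrow> (\<integral>x. indicator (box c d) x * v x \<partial>lborel) - (\<integral>x. indicator (box c d) x * h0 x \<partial>lborel)"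
    if sub: "box c d \<subseteq> ?Q" for c d
  proof -
    have int_F: "integrable lborel (\<lambda>x. indicator (box c d) x * F n x)" for n
      unfolding F_def by (rule integral_box_convolution(1)[OF v cont nonneg supp int\<eta> e])
    have lim_F: "(\<lambda>n. \<integral>x. indicator (box c d) x * F n x \<partial>lborel) \<longlonglongrightarrow> (\<integral>x. indicator (box c d) x * v x \<partial>lborel)"
      unfolding F_def by (rule integral_box_convolution(2)[OF v cont nonneg supp int\<eta> e])
    \<comment> \<open>\<open>R n\<close> integrates the error of the increments of
      \<open>F n\<close> from \<open>x1\<close>, so it tends to 0; solving for
      \<open>m (box c d) * F n x1\<close> gives the claim.\<close>
    define R where "R n = (\<integral>x. indicator (box c d) x * F n x - indicator (box c d) x * F n x1 - indicator (box c d) x * h0 x \<partial>lborel)" for n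
    have int_R: "integrable lborel (\<lambda>x. indicator (box c d) x * F n x - indicator (box c d) x * F n x1 - indicator (box c d) x * h0 x)" for n
      by (intro Bochner_Integration.integrable_diff int_F int_1 int_h0 sub)
    have R_eq: "R n = (\<integral>x. indicator (box c d) x * F n x \<partial>lborel) - m (box c d) * F n x1 - (\<integral>x. indicator (box c d) x * h0 x \<partial>lborel)" for n
      unfolding R_def using int_F[of n] int_1[of c d "F n x1"] int_h0[OF sub] by simp
    have R0: "R \<longlonglongrightarrow> 0"
    proof (rule tendstoI)
      fix \<epsilon> :: real assume \<epsilon>: "\<epsilon> > 0"
      \<comment> \<open>The added ones make \<open>S\<close> positive and strictly larger than
        \<open>m (box c d) * L\<close>, even if the box \<open>c d\<close> is empty.\<close>
      define S where "S = (L + 1) * (m (box c d) + 1)"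
      define \<epsilon>' where "\<epsilon>' = \<epsilon> / S"
      have m0: "m (box c d) \<ge> 0" by (simp add: m_def)
      have pos: "S > 0" unfolding S_def using L0 m0 by (intro mult_pos_pos) linarith+
      have \<epsilon>': "\<epsilon>' > 0" using \<epsilon> pos by (simp add: \<epsilon>'_def)
      from h0(2)[OF this] show "eventually (\<lambda>n. dist (R n) 0 < \<epsilon>) sequentially"
      proof eventually_elim
        case (elim n)
        have "\<bar>R n\<bar> \<le> (\<integral>x. indicator (box c d) x * (\<epsilon>' * L) \<partial>lborel)"
          unfolding R_def
        proof (rule integral_abs_bound[THEN order_trans], rule integral_mono)
          show "integrable lborel (\<lambda>x. \<bar>indicator (box c d) x * F n x - indicator (box c d) x * F n x1 - indicator (box c d) x * h0 x\<bar>)"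
            using int_R by (rule integrable_abs)
          show "integrable lborel (\<lambda>x. indicator (box c d) x * (\<epsilon>' * L))" by (rule int_1)
          fix x
          show "\<bar>indicator (box c d) x * F n x - indicator (box c d) x * F n x1 - indicator (box c d) x * h0 x\<bar> \<le> indicator (box c d) x * (\<epsilon>' * L)"
          proof (cases "x \<in> box c d")
            case True
            then have x: "x \<in> ?Q" using sub by blast
            have "\<bar>(F n x - F n x1) - (h0 x - h0 x1)\<bar> \<le> \<epsilon>' * ?s x1 x" using elim x x1 by blast
            also have "\<dots> \<le> \<epsilon>' * L" using \<epsilon>' s_le[OF x1 x] by (intro mult_left_mono) auto
            finally show ?thesis using True h0(1) by simp
          qed simp
        qed
        also have "\<dots> = \<epsilon>' * (m (box c d) * L)" unfolding int_1(2) by simp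
        also have "\<dots> < \<epsilon>' * S"
          unfolding S_def using \<epsilon>' L0 m0 by (intro mult_strict_left_mono) (simp_all add: algebra_simps)
        also have "\<dots> = \<epsilon>" using pos by (simp add: \<epsilon>'_def)
        finally show ?case by (simp add: dist_real_def)
      qed
    qed
    have "(\<lambda>n. (\<integral>x. indicator (box c d) x * F n x \<partial>lborel) - R n - (\<integral>x. indicator (box c d) x * h0 x \<partial>lborel)) \<longlonglongrightarrow>
      (\<integral>x. indicator (box c d) x * v x \<partial>lborel) - 0 - (\<integral>x. indicator (box c d) x * h0 x \<partial>lborel)"
      by (intro tendsto_diff lim_F R0 tendsto_const)
    then show ?thesis by (simp add: R_eq)
  qed
  have mQ: "m ?Q > 0"
  proof -
    have lt: "a $ i < b $ i" for i using x1 less_trans by (auto simp: mem_box_cart)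
    have "a \<bullet> u < b \<bullet> u" if "u \<in> Basis" for u
      using that lt by (auto simp: Basis_vec_def inner_axis)
    then show ?thesis unfolding m_def by (subst measure_lborel_box) (auto simp: inner_diff_left less_imp_le intro!: prod_pos)
  qed
  \<comment> \<open>The mean of \<open>v - h0\<close> over the whole box. Because the limit of
    \<open>F n x1\<close> does not depend on the sub-box, the same constant serves all of
    them.\<close>
  define c0 where "c0 = ((\<integral>x. indicator ?Q x * v x \<partial>lborel) - (\<integral>x. indicator ?Q x * h0 x \<partial>lborel)) / m ?Q"
  have "(\<lambda>n. m ?Q * F n x1 / m ?Q) \<longlonglongrightarrow> c0"
    unfolding c0_def by (intro tendsto_divide box_lim tendsto_const) (use mQ in auto)
  then have lim_c0: "(\<lambda>n. F n x1) \<longlonglongrightarrow> c0" using mQ by simp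
  define h where "h x = h0 x + c0" for x
  have box_eq: "(\<integral>x. indicator (box c d) x * (v x - h x) \<partial>lborel) = 0" if sub: "box c d \<subseteq> ?Q" for c d
  proof -
    have "(\<lambda>n. m (box c d) * F n x1) \<longlonglongrightarrow> m (box c d) * c0" by (intro tendsto_mult tendsto_const lim_c0)
    then have "m (box c d) * c0 = (\<integral>x. indicator (box c d) x * v x \<partial>lborel) - (\<integral>x. indicator (box c d) x * h0 x \<partial>lborel)"
      using box_lim[OF sub] LIMSEQ_unique by blast
    moreover have "(\<integral>x. indicator (box c d) x * (v x - h x) \<partial>lborel)
       = (\<integral>x. indicator (box c d) x * v x - indicator (box c d) x * h0 x - indicator (box c d) x * c0 \<partial>lborel)"
      by (simp add: h_def algebra_simps)
    moreover have "\<dots> = (\<integral>x. indicator (box c d) x * v x \<partial>lborel) - (\<integral>x. indicator (box c d) x * h0 x \<partial>lborel) - m (box c d) * c0"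
      using int_v[of c d] int_h0[OF sub] int_1[of c d c0] by simp
    ultimately show ?thesis by simp
  qed
  have int_w: "integrable lborel (\<lambda>x. indicator ?Q x * (v x - h x))"
  proof -
    have "integrable lborel (\<lambda>x. indicator ?Q x * v x - indicator ?Q x * h0 x - indicator ?Q x * c0)"
      by (intro Bochner_Integration.integrable_diff int_v int_h0 int_1) simp
    then show ?thesis by (simp add: h_def algebra_simps)
  qed
  have "AE x in lborel. indicator ?Q x * (v x - h x) = 0"
  proof (rule AE_zero_if_box_integrals_zero[OF int_w])
    fix c d
    \<comment> \<open>An arbitrary test box meets \<open>?Q\<close> in a box again, which reduces to
      the sub-boxes already handled.\<close>
    obtain c' d' where cd: "box c d \<inter> ?Q = box c' d'" using box_Int_box by blast
    have eq: "indicator (box c d) x * (indicator ?Q x * (v x - h x)) = indicator (box c' d') x * (v x - h x)" for x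
      unfolding cd[symmetric] by (simp add: indicator_def)
    show "(\<integral>x. indicator (box c d) x * (indicator ?Q x * (v x - h x)) \<partial>lborel) = 0"
      unfolding eq using cd by (intro box_eq) blast
  qed
  then have ae: "AE x in lborel. x \<in> ?Q \<longrightarrow> v x = h x"
    by eventually_elim (auto simp: indicator_def)
  have lim: "(\<lambda>n. F n x) \<longlonglongrightarrow> h x" if x: "x \<in> ?Q" for x
  proof -
    have "(\<lambda>n. F n x - F n x1) \<longlonglongrightarrow> h0 x"
    proof (rule tendstoI)
      fix \<epsilon> :: real assume \<epsilon>: "\<epsilon> > 0"
      define \<epsilon>' where "\<epsilon>' = \<epsilon> / (L + 1)"
      have pos: "L + 1 > 0" using L0 by linarith
      have \<epsilon>': "\<epsilon>' > 0" using \<epsilon> pos by (simp add: \<epsilon>'_def)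
      from h0(2)[OF this] show "eventually (\<lambda>n. dist (F n x - F n x1) (h0 x) < \<epsilon>) sequentially"
      proof eventually_elim
        case (elim n)
        have "\<bar>(F n x - F n x1) - (h0 x - h0 x1)\<bar> \<le> \<epsilon>' * ?s x1 x" using elim x x1 by blast
        also have "\<dots> \<le> \<epsilon>' * L" using \<epsilon>' s_le[OF x1 x] by (intro mult_left_mono) auto
        also have "\<dots> < \<epsilon>' * (L + 1)" using \<epsilon>' by (intro mult_strict_left_mono) auto
        also have "\<dots> = \<epsilon>" using pos by (simp add: \<epsilon>'_def)
        finally show ?case using h0(1) by (simp add: dist_real_def)
      qed
    qed
    from tendsto_add[OF this lim_c0] show ?thesis by (simp add: h_def)
  qed
  have deriv: "((\<lambda>t. h (x + t *\<^sub>R axis j 1)) has_real_derivative G j x) (at 0)" if "x \<in> ?Q" for j x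
    unfolding h_def using DERIV_add[OF h0(3)[OF that] DERIV_const[of c0]] by simp
  have "continuous_on ?Q h" unfolding h_def by (intro continuous_on_add cont_h0 continuous_on_const)
  then show ?thesis using lim deriv ae unfolding F_def by blast
qed

section \<open>Reflected mollifiers as test functions\<close>

lemma ck_reflect:
  assumes "ck m UNIV \<eta>"
  shows "ck m UNIV (\<lambda>y. \<eta> (x - y))"
  using assms
proof (induction m arbitrary: \<eta>)
  case 0
  then show ?case
    by (auto intro!: continuous_on_compose2[of UNIV \<eta> UNIV "\<lambda>y. x - y"] continuous_intros)
next
  case (Suc m)
  show ?case
  proof (rule ck_SucI[where D="\<lambda>j y. - partial j \<eta> (x - y)"])
    show "continuous_on UNIV (\<lambda>y. \<eta> (x - y))"
      using ck_imp_continuous_on[OF Suc.prems] by (auto intro!: continuous_on_compose2[of UNIV \<eta> UNIV "\<lambda>y. x - y"] continuous_intros)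
    show "((\<lambda>t. \<eta> (x - (y + t *\<^sub>R axis j 1))) has_real_derivative - partial j \<eta> (x - y)) (at 0)" for j y
    proof -
      have "((\<lambda>s. \<eta> ((x - y) + s *\<^sub>R axis j 1)) has_real_derivative partial j \<eta> (x - y)) (at (- 0))"
        using ck_SucD[OF Suc.prems, of "x - y" j] by simp
      then have "((\<lambda>s. \<eta> ((x - y) + (- s) *\<^sub>R axis j 1)) has_real_derivative - partial j \<eta> (x - y)) (at 0)"
        by (subst (asm) DERIV_mirror)
      then show ?thesis by (simp add: algebra_simps)
    qed
    show "ck m UNIV (\<lambda>y. - partial j \<eta> (x - y))" for j
      by (intro ck_minus open_UNIV Suc.IH ck_Suc_partial Suc.prems)
  qed simp
qed

text \<open>The sign from the reflection cancels the minus of integration by parts in the weak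
  derivative.\<close>

lemma partial_reflect:
  assumes "ck (Suc 0) UNIV \<eta>"
  shows "partial j (\<lambda>y. \<eta> (x - y)) y = - partial j \<eta> (x - y)"
proof (rule partial_eqI)
  have "((\<lambda>s. \<eta> ((x - y) + s *\<^sub>R axis j 1)) has_real_derivative partial j \<eta> (x - y)) (at (- 0))"
    using ck_SucD[OF assms, of "x - y" j] by simp
  then have "((\<lambda>s. \<eta> ((x - y) + (- s) *\<^sub>R axis j 1)) has_real_derivative - partial j \<eta> (x - y)) (at 0)"
    by (subst (asm) DERIV_mirror)
  then show "((\<lambda>t. \<eta> (x - (y + t *\<^sub>R axis j 1))) has_real_derivative - partial j \<eta> (x - y)) (at 0)"
    by (simp add: algebra_simps)
qed

lemma smooth_on_subset: "smooth_on U h \<Longrightarrow> V \<subseteq> U \<Longrightarrow> smooth_on V h"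
  unfolding smooth_on_def by (meson continuous_on_subset subsetD)

section \<open>Passage from Lebesgue measurable functions on an open set to Borel functions on the
  whole space\<close>

lemma Lp_imp_integrable_on_compact:
  fixes u :: "'a::euclidean_space \<Rightarrow> real"
  assumes u: "u \<in> borel_measurable (lebesgue_on \<Omega>)" "(\<integral>\<^sup>+ x. ennreal (norm (u x) powr p) \<partial>(lebesgue_on \<Omega>)) < \<infinity>"
    and p: "p \<ge> 1" and \<Omega>: "open \<Omega>" and K: "compact K" "K \<subseteq> \<Omega>"
  shows "integrable lebesgue (\<lambda>x. indicator K x * u x)"
proof (rule integrableI_bounded)
  have \<Omega>': "\<Omega> \<in> sets lebesgue" "K \<in> sets lebesgue" using \<Omega> lmeasurable_compact[OF K(1)] by (simp_all add: fmeasurableD)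
  have "(\<lambda>x. indicator \<Omega> x *\<^sub>R u x) \<in> borel_measurable lebesgue"
    using u(1) borel_measurable_restrict_space_iff[of \<Omega> lebesgue u] \<Omega>' by simp
  then have "(\<lambda>x. indicator K x *\<^sub>R (indicator \<Omega> x *\<^sub>R u x)) \<in> borel_measurable lebesgue"
    by (rule borel_measurable_scaleR[OF borel_measurable_indicator[OF \<Omega>'(2)]])
  moreover have "(\<lambda>x. indicator K x *\<^sub>R (indicator \<Omega> x *\<^sub>R u x)) = (\<lambda>x. indicator K x * u x)"
    using K(2) by (auto simp: indicator_def fun_eq_iff)
  ultimately show "(\<lambda>x. indicator K x * u x) \<in> borel_measurable lebesgue" by (simp only:)
  have meas: "(\<lambda>x. ennreal (norm (u x) powr p) * indicator \<Omega> x) \<in> borel_measurable lebesgue"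
  proof -
    have m: "(\<lambda>x. ennreal (norm (u x) powr p)) \<in> borel_measurable (lebesgue_on \<Omega>)" using u(1) by measurable
    have "\<Omega> \<inter> space lebesgue \<in> sets lebesgue" using \<Omega>' by simp
    from iffD1[OF borel_measurable_restrict_space_iff_ennreal[OF this] m] show ?thesis .
  qed
  have "(\<integral>\<^sup>+ x. ennreal (norm (indicator K x * u x)) \<partial>lebesgue)
    \<le> (\<integral>\<^sup>+ x. indicator K x + ennreal (norm (u x) powr p) * indicator \<Omega> x \<partial>lebesgue)"
  proof (rule nn_integral_mono)
    fix x
    show "ennreal (norm (indicator K x * u x)) \<le> indicator K x + ennreal (norm (u x) powr p) * indicator \<Omega> x"
    proof (cases "x \<in> K")
      case True
      \<comment> \<open>This replaces Hoelder's inequality; the summand 1 is harmless because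
        \<open>K\<close> has finite measure.\<close>
      have "\<bar>u x\<bar> \<le> 1 + \<bar>u x\<bar> powr p"
      proof (cases "\<bar>u x\<bar> \<le> 1")
        case False
        then have "\<bar>u x\<bar> powr 1 \<le> \<bar>u x\<bar> powr p" using p by (intro powr_mono) auto
        then show ?thesis using False by simp
      qed (simp add: add_increasing2)
      then have "ennreal \<bar>u x\<bar> \<le> ennreal (1 + \<bar>u x\<bar> powr p)" by (rule ennreal_leI)
      then show ?thesis using True K by (auto simp: ennreal_plus)
    qed simp
  qed
  also have "\<dots> = emeasure lebesgue K + (\<integral>\<^sup>+ x. ennreal (norm (u x) powr p) \<partial>(lebesgue_on \<Omega>))"
    using meas \<Omega>' by (subst nn_integral_add) (auto simp: nn_integral_restrict_space)
  also have "\<dots> < \<infinity>"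
    using u(2) lmeasurable_compact[OF K(1)] by (auto simp: fmeasurable_def)
  finally show "(\<integral>\<^sup>+ x. ennreal (norm (indicator K x * u x)) \<partial>lebesgue) < \<infinity>" .
qed

text \<open>The convolution lemmas use product measures and translations of \<open>lborel\<close>,
  while the Sobolev hypotheses concern Lebesgue measurable functions.\<close>

lemma borel_representative:
  fixes u :: "'a::euclidean_space \<Rightarrow> real"
  assumes "integrable lebesgue u"
  obtains v where "integrable lborel v" "AE x in lborel. u x = v x"
proof -
  obtain v where v: "v \<in> borel_measurable lborel" "AE x in lborel. u x = v x"
    using completion_ex_borel_measurable_real[OF borel_measurable_integrable[OF assms]] by blast
  have "integrable lebesgue v"
    using assms by (rule integrable_cong_AE_imp) (use v in \<open>auto intro: measurable_completion AE_completion elim!: AE_mp simp: eq_commute\<close>)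
  then have "integrable lborel v" using v(1) by (simp add: integrable_completion)
  then show thesis using that v(2) by blast
qed

text \<open>Since \<open>\<psi>\<close> vanishes off \<open>K\<close>, cutting \<open>u\<close> off
  at \<open>K\<close> does not change the integral, and neither does an almost everywhere
  modification.\<close>

lemma integral_lebesgue_on_eq_lborel:
  fixes u v \<psi> :: "'a::euclidean_space \<Rightarrow> real"
  assumes \<Omega>: "open \<Omega>" and K: "K \<subseteq> \<Omega>" and v: "v \<in> borel_measurable borel" "AE x in lborel. indicator K x * u x = v x"
    and u: "(\<lambda>x. indicator K x * u x) \<in> borel_measurable lebesgue"
    and \<psi>: "\<psi> \<in> borel_measurable borel" "\<And>y. y \<notin> K \<Longrightarrow> \<psi> y = 0"
  shows "(\<integral>y. u y * \<psi> y \<partial>lebesgue_on \<Omega>) = (\<integral>y. v y * \<psi> y \<partial>lborel)"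
proof -
  have "(\<integral>y. u y * \<psi> y \<partial>lebesgue_on \<Omega>) = (\<integral>y. indicator \<Omega> y *\<^sub>R (u y * \<psi> y) \<partial>lebesgue)"
    using \<Omega> by (intro integral_restrict_space) simp
  also have "\<dots> = (\<integral>y. (indicator K y * u y) * \<psi> y \<partial>lebesgue)"
    using K \<psi>(2) by (intro Bochner_Integration.integral_cong refl) (auto simp: indicator_def)
  also have "\<dots> = (\<integral>y. v y * \<psi> y \<partial>lebesgue)"
  proof (rule integral_cong_AE)
    have \<psi>': "\<psi> \<in> borel_measurable lebesgue" "v \<in> borel_measurable lebesgue"
      using \<psi>(1) v(1) by (auto intro: measurable_completion)
    show "(\<lambda>y. (indicator K y * u y) * \<psi> y) \<in> borel_measurable lebesgue" using u \<psi>'(1) by (rule borel_measurable_times)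
    show "(\<lambda>y. v y * \<psi> y) \<in> borel_measurable lebesgue" using \<psi>'(2,1) by (rule borel_measurable_times)
    have "AE x in lebesgue. indicator K x * u x = v x" using v(2) by (rule AE_completion)
    then show "AE y in lebesgue. (indicator K y * u y) * \<psi> y = v y * \<psi> y" by eventually_elim simp
  qed
  also have "\<dots> = (\<integral>y. v y * \<psi> y \<partial>lborel)"
    using v(1) \<psi>(1) by (intro integral_completion) simp
  finally show ?thesis .
qed

theorem continuous_weak_gradient_imp_classical:
  fixes u :: "real^'n::finite \<Rightarrow> real" and G :: "'n \<Rightarrow> real^'n \<Rightarrow> real"
  assumes \<Omega>: "open \<Omega>" and p: "p \<ge> 1"
    and u: "u \<in> borel_measurable (lebesgue_on \<Omega>)" "(\<integral>\<^sup>+ x. ennreal (norm (u x) powr p) \<partial>(lebesgue_on \<Omega>)) < \<infinity>"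
    and G: "\<And>j. continuous_on \<Omega> (G j)"
    and weak: "\<And>\<phi> j. test_fun \<Omega> \<phi> \<Longrightarrow>
      (\<integral>x. u x * partial j \<phi> x \<partial>lebesgue_on \<Omega>) = - (\<integral>x. G j x * \<phi> x \<partial>lebesgue_on \<Omega>)"
  shows "\<exists>h. continuous_on \<Omega> h
    \<and> (\<forall>j. \<forall>x\<in>\<Omega>. ((\<lambda>t. h (x + t *\<^sub>R axis j 1)) has_real_derivative G j x) (at 0))
    \<and> (AE x in lborel. x \<in> \<Omega> \<longrightarrow> u x = h x)"
proof -
  define e :: "nat \<Rightarrow> real" where "e n = inverse (real (Suc n))" for n
  have e: "e \<longlonglongrightarrow> 0" unfolding e_def by (rule LIMSEQ_inverse_real_of_nat)
  have "\<exists>\<eta> :: real^'n \<Rightarrow> real. smooth_on UNIV \<eta> \<and> (\<forall>x. 0 \<le> \<eta> x) \<and> (\<forall>x. e n < norm x \<longrightarrow> \<eta> x = 0)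
    \<and> integrable lborel \<eta> \<and> integral\<^sup>L lborel \<eta> = 1" for n
    by (rule ex_mollifier) (simp add: e_def)
  then obtain \<eta> :: "nat \<Rightarrow> real^'n \<Rightarrow> real" where \<eta>: "\<And>n. smooth_on UNIV (\<eta> n)" "\<And>n z. 0 \<le> \<eta> n z"
    "\<And>n z. e n < norm z \<Longrightarrow> \<eta> n z = 0" "\<And>n. integrable lborel (\<eta> n)" "\<And>n. integral\<^sup>L lborel (\<eta> n) = 1"
    by metis
  have ck: "ck m UNIV (\<eta> n)" for m n using \<eta>(1) by (simp add: smooth_on_iff_ck)
  have c: "continuous_on UNIV (\<eta> n)" "continuous_on UNIV (partial j (\<eta> n))" for j n
    using ck[of "Suc 0" n] by simp_all
  have [measurable]: "\<eta> n \<in> borel_measurable borel" "partial j (\<eta> n) \<in> borel_measurable borel" for n j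
    using c by (auto intro: borel_measurable_continuous_onI)
  \<comment> \<open>\<open>F\<close> and its limit \<open>h\<close> are defined from
    \<open>u\<close> itself, before any localisation. The local limits are then restrictions of one
    function, and no gluing of constants is needed.\<close>
  define F where "F n x = (\<integral>y. u y * \<eta> n (x - y) \<partial>lebesgue_on \<Omega>)" for n x
  define h where "h x = lim (\<lambda>n. F n x)" for x
  define good where "good x0 Q \<longleftrightarrow> open Q \<and> x0 \<in> Q \<and> continuous_on Q h
     \<and> (\<forall>j. \<forall>x\<in>Q. ((\<lambda>t. h (x + t *\<^sub>R axis j 1)) has_real_derivative G j x) (at 0))
     \<and> (AE x in lborel. x \<in> Q \<longrightarrow> u x = h x)" for x0 Q
  have loc: "\<exists>Q. good x0 Q" if x0: "x0 \<in> \<Omega>" for x0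
  proof -
    obtain \<rho>0 where \<rho>0: "\<rho>0 > 0" "cball x0 \<rho>0 \<subseteq> \<Omega>" using \<Omega> x0 open_contains_cball by metis
    \<comment> \<open>A box of half side \<open>r\<close> stays within distance
      \<open>\<rho>0 / 2\<close> of \<open>x0\<close>, by the coordinate sum bound on the norm; the
      other half of \<open>\<rho>0\<close> is the margin \<open>\<rho>\<close> for the
      mollifiers.\<close>
    define r where "r = \<rho>0 / (2 * CARD('n))"
    define K where "K = cball x0 \<rho>0"
    define \<rho> where "\<rho> = \<rho>0 / 2"
    define a b where "a = (\<chi> i. x0 $ i - r)" and "b = (\<chi> i. x0 $ i + r)"
    have r: "r > 0" using \<rho>0 by (simp add: r_def)
    have \<rho>: "\<rho> > 0" using \<rho>0 by (simp add: \<rho>_def)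
    have K: "compact K" "K \<subseteq> \<Omega>" using \<rho>0 by (simp_all add: K_def)
    have x0Q: "x0 \<in> box a b" using r by (simp add: mem_box_cart a_def b_def)
    have dist: "dist x0 x \<le> \<rho>" if "x \<in> box a b" for x
    proof -
      have "\<bar>(x0 - x) $ i\<bar> \<le> r" for i using that by (auto simp: mem_box_cart a_def b_def abs_le_iff dest!: spec[of _ i])
      then have "norm (x0 - x) \<le> (\<Sum>i\<in>(UNIV::'n set). r)"
        by (intro order_trans[OF norm_le_l1_cart] sum_mono)
      also have "\<dots> = \<rho>" by (simp add: r_def \<rho>_def)
      finally show ?thesis by (simp add: dist_norm)
    qed
    have sub: "cball x \<rho> \<subseteq> K" if "x \<in> box a b" for x
    proof
      fix y assume "y \<in> cball x \<rho>"
      then have "dist x0 y \<le> \<rho> + \<rho>" using dist[OF that] dist_triangle[of x0 y x] by simp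
      then show "y \<in> K" by (simp add: K_def \<rho>_def)
    qed
    have int: "integrable lebesgue (\<lambda>x. indicator K x * u x)"
      by (rule Lp_imp_integrable_on_compact[OF u p \<Omega> K])
    obtain v where v: "integrable lborel v" "AE x in lborel. indicator K x * u x = v x"
      using borel_representative[OF int] by blast
    have [measurable]: "v \<in> borel_measurable borel" using v by (auto dest: borel_measurable_integrable)
    have transfer: "(\<integral>y. u y * \<psi> y \<partial>lebesgue_on \<Omega>) = (\<integral>y. v y * \<psi> y \<partial>lborel)"
      if "\<psi> \<in> borel_measurable borel" "\<And>y. y \<notin> K \<Longrightarrow> \<psi> y = 0" for \<psi>
      by (rule integral_lebesgue_on_eq_lborel[OF \<Omega> K(2) _ v(2) borel_measurable_integrable[OF int] that]) simp_all
    have zero: "\<eta> n (x - y) = 0" "partial j (\<eta> n) (x - y) = 0" if "e n < \<rho>" "x \<in> box a b" "y \<notin> cball x (e n)" for n x y j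
    proof -
      have "e n < norm (x - y)" using that by (simp add: dist_norm)
      then show "\<eta> n (x - y) = 0" "partial j (\<eta> n) (x - y) = 0"
        using \<eta>(3) partial_zero_outside_cball[of "e n" "\<eta> n" "x - y" j] by blast+
    qed
    have sub_n: "cball x (e n) \<subseteq> K" if "e n < \<rho>" "x \<in> box a b" for n x
      using sub[OF that(2)] that(1) by (meson less_imp_le order_trans subset_cball)
    have zero_K: "\<eta> n (x - y) = 0" "partial j (\<eta> n) (x - y) = 0" if "e n < \<rho>" "x \<in> box a b" "y \<notin> K" for n x y j
      using zero[OF that(1,2)] sub_n[OF that(1,2)] that(3) by (meson subsetD)+
    have F_eq: "F n x = (\<integral>y. v y * \<eta> n (x - y) \<partial>lborel)" if "e n < \<rho>" "x \<in> box a b" for n x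
      unfolding F_def by (rule transfer) (simp_all add: zero_K that)
    have weak': "(\<integral>y. v y * partial j (\<eta> n) (x - y) \<partial>lborel) = (\<integral>y. G j y * \<eta> n (x - y) \<partial>lborel)"
      if nx: "e n < \<rho>" "x \<in> box a b" for n x j
    proof -
      \<comment> \<open>Mollifying at \<open>x\<close> amounts to testing with the reflected
        mollifier, whose support lies in \<open>cball x (e n)\<close> and hence in
        \<open>K\<close>.\<close>
      let ?\<phi> = "\<lambda>y. \<eta> n (x - y)"
      have cl: "closure {y. ?\<phi> y \<noteq> 0} \<subseteq> cball x (e n)"
        by (intro closure_minimal subsetI) (use zero(1)[OF nx] in \<open>simp_all, blast\<close>)
      have "bounded (closure {y. ?\<phi> y \<noteq> 0})" using cl bounded_cball bounded_subset by blast
      then have "compact (closure {y. ?\<phi> y \<noteq> 0})" by (simp add: compact_eq_bounded_closed)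
      moreover have "smooth_on UNIV ?\<phi>" unfolding smooth_on_iff_ck using ck_reflect[OF ck] by blast
      then have "smooth_on \<Omega> ?\<phi>" by (rule smooth_on_subset) simp
      ultimately have test: "test_fun \<Omega> ?\<phi>"
        unfolding test_fun_def using cl sub_n[OF nx] K(2) by blast
      have "- (\<integral>y. v y * partial j (\<eta> n) (x - y) \<partial>lborel) = (\<integral>y. v y * - partial j (\<eta> n) (x - y) \<partial>lborel)"
        by simp
      also have "\<dots> = (\<integral>y. u y * - partial j (\<eta> n) (x - y) \<partial>lebesgue_on \<Omega>)"
        by (rule transfer[symmetric]) (simp_all add: zero_K nx)
      also have "\<dots> = (\<integral>y. u y * partial j ?\<phi> y \<partial>lebesgue_on \<Omega>)"
        by (simp add: partial_reflect[OF ck])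
      also have "\<dots> = - (\<integral>y. G j y * ?\<phi> y \<partial>lebesgue_on \<Omega>)" by (rule weak[OF test])
      \<comment> \<open>\<open>G j\<close> is continuous only on \<open>\<Omega>\<close>; its
        cut-off to the compact \<open>K\<close> is Borel on the whole space and leaves the integrand
        unchanged.\<close>
      also have "(\<integral>y. G j y * ?\<phi> y \<partial>lebesgue_on \<Omega>) = (\<integral>y. indicator K y * G j y * ?\<phi> y \<partial>lborel)"
      proof (rule integral_lebesgue_on_eq_lborel[OF \<Omega> K(2)])
        have "K \<in> sets borel" using K(1) by (simp add: borel_compact)
        then show m: "(\<lambda>y. indicator K y * G j y) \<in> borel_measurable borel"
          using borel_measurable_continuous_on_indicator[of K "G j"] continuous_on_subset[OF G K(2)] by simp
        then show "(\<lambda>y. indicator K y * G j y) \<in> borel_measurable lebesgue" by (intro measurable_completion) simp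
      qed (simp_all add: zero_K nx)
      also have "\<dots> = (\<integral>y. G j y * ?\<phi> y \<partial>lborel)"
        using zero_K(1)[OF nx] by (intro Bochner_Integration.integral_cong refl) (auto simp: indicator_def)
      finally show ?thesis by simp
    qed
    obtain hq where hq: "\<And>x. x \<in> box a b \<Longrightarrow> (\<lambda>n. \<integral>y. v y * \<eta> n (x - y) \<partial>lborel) \<longlonglongrightarrow> hq x"
      "continuous_on (box a b) hq"
      "\<And>j x. x \<in> box a b \<Longrightarrow> ((\<lambda>t. hq (x + t *\<^sub>R axis j 1)) has_real_derivative G j x) (at 0)"
      "AE x in lborel. x \<in> box a b \<longrightarrow> v x = hq x"
      using weak_gradient_local[where \<eta>=\<eta> and e=e, OF v(1) K(1) continuous_on_subset[OF G K(2)] x0Q \<rho> sub \<eta> e weak'] by blast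
    have h_eq: "h x = hq x" if "x \<in> box a b" for x
    proof -
      have "eventually (\<lambda>n. e n < \<rho>) sequentially" using order_tendstoD(2)[OF e \<rho>] .
      then have "eventually (\<lambda>n. (\<integral>y. v y * \<eta> n (x - y) \<partial>lborel) = F n x) sequentially"
        by eventually_elim (simp add: F_eq that)
      from Lim_transform_eventually[OF hq(1)[OF that] this] show ?thesis
        unfolding h_def by (rule limI)
    qed
    show ?thesis unfolding good_def
    proof (intro exI[of _ "box a b"] conjI allI ballI)
      show "continuous_on (box a b) h" using hq(2) h_eq by (simp cong: continuous_on_cong)
      show "((\<lambda>t. h (x + t *\<^sub>R axis j 1)) has_real_derivative G j x) (at 0)" if x: "x \<in> box a b" for j x
      proof -
        have "eventually (\<lambda>t. h (x + t *\<^sub>R axis j 1) = hq (x + t *\<^sub>R axis j 1)) (nhds 0)"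
          by (intro eventually_mono[OF eventually_line_in_open[OF open_box x]] h_eq)
        then show ?thesis using hq(3)[OF x] by (subst DERIV_cong_ev) auto
      qed
      have "box a b \<subseteq> K" using sub \<rho> by force
      show "AE x in lborel. x \<in> box a b \<longrightarrow> u x = h x"
        using hq(4) v(2)
      proof eventually_elim
        case (elim x)
        show ?case
        proof
          assume x: "x \<in> box a b"
          then have "u x = v x" using elim(2) \<open>box a b \<subseteq> K\<close> by (auto simp: indicator_def)
          then show "u x = h x" using elim(1) x h_eq by simp
        qed
      qed
    qed (simp_all add: x0Q open_box)
  qed
  then obtain Q where good: "\<And>x. x \<in> \<Omega> \<Longrightarrow> good x (Q x)"
    using bchoice[of \<Omega> good] by blast
  have Q: "open (Q x)" "x \<in> Q x" "continuous_on (Q x) h"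
      "AE y in lborel. y \<in> Q x \<longrightarrow> u y = h y" if "x \<in> \<Omega>" for x
    using good[OF that] unfolding good_def by simp_all
  have "continuous_on \<Omega> h"
  proof (rule continuous_at_imp_continuous_on, rule ballI)
    fix x assume "x \<in> \<Omega>"
    then show "isCont h x" using Q(1-3) continuous_on_eq_continuous_at by blast
  qed
  moreover have "((\<lambda>t. h (x + t *\<^sub>R axis j 1)) has_real_derivative G j x) (at 0)" if "x \<in> \<Omega>" for j x
    using good[OF that] unfolding good_def by blast
  moreover have "AE y in lborel. y \<in> \<Omega> \<longrightarrow> u y = h y"
  proof -
    \<comment> \<open>Each neighbourhood carries its own null set; a countable subcover keeps their
      union null.\<close>
    obtain \<F> where \<F>: "\<F> \<subseteq> Q ` \<Omega>" "countable \<F>" "\<Union>\<F> = \<Union>(Q ` \<Omega>)"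
      using Lindelof[of "Q ` \<Omega>"] Q(1) by blast
    have "AE y in lborel. \<forall>B\<in>\<F>. y \<in> B \<longrightarrow> u y = h y"
      using \<F>(1) Q(4) by (subst AE_ball_countable[OF \<F>(2)]) blast
    then show ?thesis
    proof eventually_elim
      case (elim y)
      show ?case
      proof
        assume "y \<in> \<Omega>"
        then have "y \<in> \<Union>\<F>" using Q(2) \<F>(3) by blast
        then show "u y = h y" using elim by blast
      qed
    qed
  qed
  ultimately show ?thesis by blast
qed

theorem mainTheorem15:
  fixes \<Omega> :: "(real^('n::{finite,linorder})) set"
    and f :: "real^('n::{finite,linorder}) \<Rightarrow> real^('n::{finite,linorder})"
    and g :: "real^('n::{finite,linorder}) \<Rightarrow> real^('n::{finite,linorder})^('n::{finite,linorder})"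
    and k :: nat and p :: real
  assumes d: "CARD('n) > 2"
    and open_\<Omega>: "open \<Omega>"
    and k: "2 \<le> k" "k \<le> CARD('n) - 1"
    and p: "p \<ge> 1"
    and sob: "sobolev_W1p p \<Omega> f g"
    and cont: "\<forall>i j. continuous_on \<Omega> (\<lambda>x. g x $ i $ j)"
    and sgn: "(AE x in lebesgue_on \<Omega>. det (g x) > 0) \<or> (AE x in lebesgue_on \<Omega>. det (g x) < 0)"
    and ext: "\<exists>M :: real^('n::{finite,linorder}) \<Rightarrow> 'n set \<Rightarrow> 'n set \<Rightarrow> real.
                (\<forall>I\<in>ksubsets k. \<forall>J\<in>ksubsets k. smooth_on \<Omega> (\<lambda>x. M x I J))
              \<and> (\<forall>x\<in>\<Omega>. GL_ksub k (M x))
              \<and> (AE x in lebesgue_on \<Omega>. \<forall>I\<in>ksubsets k. \<forall>J\<in>ksubsets k. M x I J = ext_power k (g x) I J)"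
  shows "\<exists>h. smooth_vec_on \<Omega> h \<and> (AE x in lebesgue_on \<Omega>. f x = h x)"
proof -
  have k': "1 \<le> k" "k < CARD('n)" using k d by linarith+
  have \<Omega>_sets: "\<Omega> \<in> sets lebesgue" using open_\<Omega> by simp
  obtain M where M: "\<And>I J. I \<in> ksubsets k \<Longrightarrow> J \<in> ksubsets k \<Longrightarrow> smooth_on \<Omega> (\<lambda>x. M x I J)"
    "\<And>x. x \<in> \<Omega> \<Longrightarrow> GL_ksub k (M x)"
    "AE x in lebesgue_on \<Omega>. \<forall>I\<in>ksubsets k. \<forall>J\<in>ksubsets k. M x I J = ext_power k (g x) I J"
    using ext by blast
  have "AE x in lebesgue. x \<in> \<Omega> \<longrightarrow> (\<forall>I\<in>ksubsets k. \<forall>J\<in>ksubsets k. M x I J = ext_power k (g x) I J)"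
    using M(3) \<Omega>_sets by (simp add: AE_restrict_space_iff)
  then have ae: "AE x in lborel. x \<in> \<Omega> \<longrightarrow> (\<forall>I\<in>ksubsets k. \<forall>J\<in>ksubsets k. M x I J = ext_power k (g x) I J)"
    by (simp only: AE_completion_iff)
  \<comment> \<open>Both sides are continuous, so equality almost everywhere is equality everywhere
    on \<open>\<Omega>\<close>. This also carries the invertibility of \<open>M x\<close> over to
    \<open>g x\<close> at every single point.\<close>
  have M_eq: "M x I J = minor (g x) I J" if x: "x \<in> \<Omega>" and IJ: "I \<in> ksubsets k" "J \<in> ksubsets k" for x I J
  proof -
    have "continuous_on \<Omega> (\<lambda>x. M x I J)"
      using M(1)[OF IJ] ck_imp_continuous_on unfolding smooth_on_iff_ck by blast
    moreover have "ck 0 \<Omega> (\<lambda>x. minor (g x) I J)"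
      using cont by (intro ck_minor open_\<Omega>) simp
    then have "continuous_on \<Omega> (\<lambda>x. minor (g x) I J)" by simp
    ultimately have c: "continuous_on \<Omega> (\<lambda>x. M x I J - minor (g x) I J)" by (rule continuous_on_diff)
    have "AE x in lborel. x \<in> \<Omega> \<longrightarrow> M x I J - minor (g x) I J = 0"
      using ae by eventually_elim (use IJ in \<open>simp add: ext_power_def\<close>)
    from continuous_AE_zero[OF open_\<Omega> c this x] show ?thesis by simp
  qed
  have nz: "det (g x) \<noteq> 0" if "x \<in> \<Omega>" for x
  proof (rule GL_ksub_imp_det_nz)
    show "1 \<le> k" "k \<le> CARD('n)" using k' by simp_all
    show "GL_ksub k (minor (g x))"
      using M(2)[OF that] M_eq[OF that] unfolding GL_ksub_def by simp
  qed
  have "smooth_on \<Omega> (\<lambda>x. minor (g x) I J)" if "I \<in> ksubsets k" "J \<in> ksubsets k" for I J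
    using M(1)[OF that] smooth_on_cong[OF open_\<Omega>, of "\<lambda>x. M x I J" "\<lambda>x. minor (g x) I J"] M_eq that by simp
  then have smooth_g: "smooth_on \<Omega> (\<lambda>x. g x $ i $ j)" for i j
    using cont nz by (intro smooth_if_minors_smooth[OF open_\<Omega> k']) auto
  have f: "f \<in> borel_measurable (lebesgue_on \<Omega>)" "(\<integral>\<^sup>+ x. ennreal (norm (f x) powr p) \<partial>(lebesgue_on \<Omega>)) < \<infinity>"
    and weak: "weak_jacobian_on \<Omega> f g"
    using sob unfolding sobolev_W1p_def Lp_on_def by blast+
  define good where "good i h \<longleftrightarrow> continuous_on \<Omega> h
      \<and> (\<forall>j. \<forall>x\<in>\<Omega>. ((\<lambda>t. h (x + t *\<^sub>R axis j 1)) has_real_derivative g x $ i $ j) (at 0))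
      \<and> (AE x in lborel. x \<in> \<Omega> \<longrightarrow> f x $ i = h x)" for i h
  have "\<exists>h. good i h" for i
    unfolding good_def
  proof (rule continuous_weak_gradient_imp_classical[OF open_\<Omega> p])
    show "(\<lambda>x. f x $ i) \<in> borel_measurable (lebesgue_on \<Omega>)"
      by (rule borel_measurable_continuous_on[OF _ f(1)]) (intro continuous_on_component continuous_on_id)
    have "(\<integral>\<^sup>+ x. ennreal (norm (f x $ i) powr p) \<partial>(lebesgue_on \<Omega>)) \<le> (\<integral>\<^sup>+ x. ennreal (norm (f x) powr p) \<partial>(lebesgue_on \<Omega>))"
      using p by (intro nn_integral_mono ennreal_leI powr_mono2) (auto simp: component_le_norm_cart)
    then show "(\<integral>\<^sup>+ x. ennreal (norm (f x $ i) powr p) \<partial>(lebesgue_on \<Omega>)) < \<infinity>"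
      using f(2) by (rule order_le_less_trans)
    show "continuous_on \<Omega> (\<lambda>x. g x $ i $ j)" for j using cont by blast
    show "(\<integral>x. f x $ i * partial j \<phi> x \<partial>lebesgue_on \<Omega>) = - (\<integral>x. g x $ i $ j * \<phi> x \<partial>lebesgue_on \<Omega>)"
      if "test_fun \<Omega> \<phi>" for \<phi> j
      using weak that unfolding weak_jacobian_on_def by blast
  qed
  then obtain h where good: "\<And>i. good i (h i)"
    using choice[of good] by blast
  have h: "continuous_on \<Omega> (h i)" "AE x in lborel. x \<in> \<Omega> \<longrightarrow> f x $ i = h i x"
    "\<And>j x. x \<in> \<Omega> \<Longrightarrow> ((\<lambda>t. h i (x + t *\<^sub>R axis j 1)) has_real_derivative g x $ i $ j) (at 0)" for i
    using good[of i] unfolding good_def by simp_all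
  \<comment> \<open>The partial derivatives of \<open>h i\<close> are the entries of row
    \<open>i\<close> of \<open>g\<close>, already known to be smooth, so \<open>h i\<close> is one
    order better than they are.\<close>
  have "ck m \<Omega> (h i)" for m i
  proof (cases m)
    case (Suc m')
    have "ck m' \<Omega> (\<lambda>x. g x $ i $ j)" for j using smooth_g by (simp add: smooth_on_iff_ck)
    then show ?thesis unfolding Suc by (intro ck_SucI[OF open_\<Omega> h(1) h(3)])
  qed (simp add: h(1))
  then have "smooth_vec_on \<Omega> (\<lambda>x. \<chi> i. h i x)"
    unfolding smooth_vec_on_def smooth_on_iff_ck by simp
  moreover have "AE x in lebesgue_on \<Omega>. f x = (\<chi> i. h i x)"
  proof -
    have "AE x in lborel. \<forall>i. x \<in> \<Omega> \<longrightarrow> f x $ i = h i x"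
      using h(2) by (intro eventually_all_finite)
    then have "AE x in lebesgue. \<forall>i. x \<in> \<Omega> \<longrightarrow> f x $ i = h i x" by (rule AE_completion)
    then have "AE x in lebesgue. x \<in> \<Omega> \<longrightarrow> f x = (\<chi> i. h i x)" by eventually_elim (simp add: vec_eq_iff)
    then show ?thesis using \<Omega>_sets by (simp add: AE_restrict_space_iff)
  qed
  ultimately show ?thesis by blast
qed

end
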